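(* Let $(X,\phi)$ be a Toroidal Belyi pair, and let $G = \phi^{-1}\bigl(\{0,1,\infty\}\bigr) \subseteq X(\mathbb{C})$ be its set of quasi-critical points. Let $E$ be an elliptic curve over $\mathbb{C}$, let $\psi: E(\mathbb{C}) \to X(\mathbb{C})$ be any non-constant isogeny, put $\beta = \phi \circ \psi$, and let $\Gamma = \beta^{-1}\bigl(\{0,1,\infty\}\bigr) \subseteq E(\mathbb{C})$. Then: (1) $(E,\beta)$ is a Toroidal Belyi pair. (2) If $G \subseteq X(\mathbb{C})_{\mathrm{tors}}$, then $\Gamma \subseteq E(\mathbb{C})_{\mathrm{tors}}$. (3) If $G$ is a subgroup of $(X(\mathbb{C}),\oplus)$, then $\Gamma$ is a subgroup of $(E(\mathbb{C}),\oplus)$.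
   Context: An elliptic curve $E$ over $\mathbb{C}$ is a non-singular curve given by a Weierstrass equation $y^2 + a_1 xy + a_3 y = x^3 + a_2 x^2 + a_4 x + a_6$ with $a_i \in \mathbb{C}$; $E(\mathbb{C})$ is its set of complex points together with the point at infinity $O_E$, an abelian group under the chord-tangent law $\oplus$ with identity $O_E$. $E(\mathbb{C})_{\mathrm{tors}}$ denotes the set of points of finite order. An isogeny is a morphism of elliptic curves over $\mathbb{C}$ that is a group homomorphism on complex points. For a non-constant meromorphic (rational) function $\beta: E(\mathbb{C}) \to \mathbb{P}^1(\mathbb{C})$, a critical point is a point $P$ at which the ramification index $e_\beta(P)$ is at least $2$, and a critical value is the image of a critical point. A Toroidal Belyi pair $(E,\beta)$ consists of an elliptic curve $E$ over $\mathbb{C}$ and a non-constant meromorphic function $\beta: E(\mathbb{C}) \to \mathbb{P}^1(\mathbb{C})$ all of whose critical values lie in $\{0,1,\infty\}$. Its set of quasi-critical points is $\beta^{-1}(\{0,1,\infty\})$. *)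

theory Defs
  imports "HOL-Complex_Analysis.Complex_Analysis" "HOL-Algebra.Coset"
begin

no_notation fps_nth (infixl "$" 75)

section \<open>Weierstrass curves and the chord-tangent law\<close>

datatype weierstrass =
  Weierstrass (a\<^sub>1: complex) (a\<^sub>2: complex) (a\<^sub>3: complex) (a\<^sub>4: complex) (a\<^sub>6: complex)

text \<open>Points of the projective plane that can lie on a Weierstrass curve:
  \<^term>\<open>Aff x y\<close> is \<open>[x : y : 1]\<close>, and \<^term>\<open>O_pt\<close> is \<open>[0 : 1 : 0]\<close>,
  the only point of such a curve on the line at infinity.\<close>

datatype point = O_pt | Aff complex complex

definition points :: "weierstrass \<Rightarrow> point set" where
  "points E = insert O_pt
     {Aff x y | x y. y\<^sup>2 + a\<^sub>1 E * x * y + a\<^sub>3 E * y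
                       = x^3 + a\<^sub>2 E * x\<^sup>2 + a\<^sub>4 E * x + a\<^sub>6 E}"

text \<open>Non-singularity: the two partial derivatives of the affine equation have no common zero
  on the curve. The point \<open>[0 : 1 : 0]\<close> needs no condition, because the \<open>Z\<close>-derivative of the
  homogenised equation equals 1 there.\<close>

definition elliptic_curve :: "weierstrass \<Rightarrow> bool" where
  "elliptic_curve E \<longleftrightarrow> (\<forall>x y. Aff x y \<in> points E \<longrightarrow>
     \<not> (a\<^sub>1 E * y - (3 * x\<^sup>2 + 2 * a\<^sub>2 E * x + a\<^sub>4 E) = 0 \<and> 2 * y + a\<^sub>1 E * x + a\<^sub>3 E = 0))"

text \<open>The vertical line through \<open>(x, y)\<close> meets the curve again at the following point.\<close>

fun ec_neg :: "weierstrass \<Rightarrow> point \<Rightarrow> point" where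
  "ec_neg E O_pt = O_pt"
| "ec_neg E (Aff x y) = Aff x (- y - a\<^sub>1 E * x - a\<^sub>3 E)"

text \<open>Slope of the chord, or of the tangent if the points coincide; used only for two points
  that are not opposite, so that equal \<open>x\<close>-coordinates force the points to be equal.\<close>

fun ec_slope :: "weierstrass \<Rightarrow> complex \<times> complex \<Rightarrow> complex \<times> complex \<Rightarrow> complex" where
  "ec_slope E (x1, y1) (x2, y2) =
     (if x1 = x2
      then (3 * x1\<^sup>2 + 2 * a\<^sub>2 E * x1 + a\<^sub>4 E - a\<^sub>1 E * y1) / (2 * y1 + a\<^sub>1 E * x1 + a\<^sub>3 E)
      else (y2 - y1) / (x2 - x1))"

text \<open>Substituting the line \<open>y = y1 + l (x - x1)\<close> into the equation gives a monic cubic in \<open>x\<close>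
  whose roots sum to \<open>l\<^sup>2 + a\<^sub>1 l - a\<^sub>2\<close>; this yields the third intersection point, and the sum is
  its negative.\<close>

fun ec_add :: "weierstrass \<Rightarrow> point \<Rightarrow> point \<Rightarrow> point" where
  "ec_add E O_pt Q = Q"
| "ec_add E P O_pt = P"
| "ec_add E (Aff x1 y1) (Aff x2 y2) =
     (if Aff x2 y2 = ec_neg E (Aff x1 y1) then O_pt
      else let l = ec_slope E (x1, y1) (x2, y2);
               x3 = l\<^sup>2 + a\<^sub>1 E * l - a\<^sub>2 E - x1 - x2
           in ec_neg E (Aff x3 (y1 + l * (x3 - x1))))"

definition ec_group :: "weierstrass \<Rightarrow> point monoid" where
  "ec_group E = \<lparr>carrier = points E, monoid.mult = ec_add E, one = O_pt\<rparr>"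

definition torsion_points :: "weierstrass \<Rightarrow> point set" where
  "torsion_points E =
     {P \<in> points E. \<exists>n::nat. n > 0 \<and> P [^]\<^bsub>ec_group E\<^esub> n = \<one>\<^bsub>ec_group E\<^esub>}"


section \<open>Morphisms from Weierstrass curves to projective spaces\<close>

fun hcoords :: "point \<Rightarrow> complex ^ 3" where
  "hcoords O_pt = vector [0, 1, 0]"
| "hcoords (Aff x y) = vector [x, y, 1]"

datatype P1 = Fin complex | Infty

fun P1_hcoords :: "P1 \<Rightarrow> complex ^ 2" where
  "P1_hcoords (Fin z) = vector [z, 1]"
| "P1_hcoords Infty = vector [1, 0]"

text \<open>Homogeneous polynomials of degree \<open>d\<close> in three variables, as functions.\<close>

definition form :: "nat \<Rightarrow> (complex ^ 3 \<Rightarrow> complex) \<Rightarrow> bool" where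
  "form d F \<longleftrightarrow> (\<exists>c :: nat \<Rightarrow> nat \<Rightarrow> complex. \<forall>v.
     F v = (\<Sum>i\<le>d. \<Sum>j\<le>d - i. c i j * (v $ 1) ^ i * (v $ 2) ^ j * (v $ 3) ^ (d - i - j)))"

text \<open>A map \<open>f\<close> from the curve to a projective space (with \<open>h\<close> choosing homogeneous coordinates of
  points of the target) is a morphism if around each point \<open>P\<close> it is given by forms of equal
  degree without common zero at \<open>P\<close>. Since the curve is irreducible, such a representation is valid
  wherever the forms have no common zero.\<close>

definition projective_morphism ::
  "weierstrass \<Rightarrow> ('q \<Rightarrow> complex ^ 'n) \<Rightarrow> (point \<Rightarrow> 'q) \<Rightarrow> bool" where
  "projective_morphism E h f \<longleftrightarrow> (\<forall>P \<in> points E.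
     \<exists>d F. (\<forall>i. form d (F i)) \<and> (\<chi> i. F i (hcoords P)) \<noteq> 0 \<and>
       (\<forall>Q \<in> points E. (\<chi> i. F i (hcoords Q)) \<noteq> 0 \<longrightarrow>
          (\<exists>c. c \<noteq> 0 \<and> (\<chi> i. F i (hcoords Q)) = c *s h (f Q))))"

definition isogeny :: "weierstrass \<Rightarrow> weierstrass \<Rightarrow> (point \<Rightarrow> point) \<Rightarrow> bool" where
  "isogeny E X \<psi> \<longleftrightarrow>
     projective_morphism E hcoords \<psi> \<and> \<psi> \<in> hom (ec_group E) (ec_group X)"

text \<open>Meromorphic functions on the projective curve are rational functions, that is,
  morphisms to the projective line; the constant \<^term>\<open>Infty\<close> is excluded by non-constancy.\<close>

definition nonconstant_meromorphic :: "weierstrass \<Rightarrow> (point \<Rightarrow> P1) \<Rightarrow> bool" where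
  "nonconstant_meromorphic E \<beta> \<longleftrightarrow>
     projective_morphism E P1_hcoords \<beta> \<and> \<not> \<beta> constant_on points E"


section \<open>Ramification and Belyi pairs\<close>

text \<open>Inverses of local holomorphic charts of the Riemann surface \<^term>\<open>points E\<close> centred at \<open>P\<close>:
  holomorphic maps into the projective plane with values in the curve that are immersive at \<open>0\<close>.
  In a homogeneous lift \<open>u\<close>, immersivity says that \<open>u'(0)\<close> is not a multiple of \<open>u(0)\<close>.\<close>

definition local_param :: "weierstrass \<Rightarrow> point \<Rightarrow> (complex \<Rightarrow> point) \<Rightarrow> bool" where
  "local_param E P \<gamma> \<longleftrightarrow> \<gamma> 0 = P \<and>
     (\<exists>r > 0. \<exists>u :: complex \<Rightarrow> complex ^ 3.
        (\<forall>i. (\<lambda>t. u t $ i) holomorphic_on ball 0 r) \<and>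
        (\<forall>t \<in> ball 0 r. \<gamma> t \<in> points E \<and> (\<exists>c. c \<noteq> 0 \<and> u t = c *s hcoords (\<gamma> t))) \<and>
        (\<nexists>c. (\<chi> i. deriv (\<lambda>t. u t $ i) 0) = c *s u 0))"

text \<open>\<^term>\<open>P1_chart w\<close> is a local coordinate of the projective line vanishing at \<open>w\<close>.
  Values at points outside the domain of the chart are irrelevant.\<close>

fun P1_chart :: "P1 \<Rightarrow> P1 \<Rightarrow> complex" where
  "P1_chart (Fin w) (Fin z) = z - w"
| "P1_chart (Fin w) Infty = 0"
| "P1_chart Infty (Fin z) = 1 / z"
| "P1_chart Infty Infty = 0"

text \<open>Order of vanishing at \<open>P\<close> of \<open>\<beta>\<close> in local coordinates, which does not depend on the
  choice of the parametrisation.\<close>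

definition ramification_index :: "weierstrass \<Rightarrow> (point \<Rightarrow> P1) \<Rightarrow> point \<Rightarrow> nat" where
  "ramification_index E \<beta> P =
     (THE e. \<forall>\<gamma>. local_param E P \<gamma> \<longrightarrow> zorder (\<lambda>t. P1_chart (\<beta> P) (\<beta> (\<gamma> t))) 0 = int e)"

definition critical_points :: "weierstrass \<Rightarrow> (point \<Rightarrow> P1) \<Rightarrow> point set" where
  "critical_points E \<beta> = {P \<in> points E. ramification_index E \<beta> P \<ge> 2}"

definition critical_values :: "weierstrass \<Rightarrow> (point \<Rightarrow> P1) \<Rightarrow> P1 set" where
  "critical_values E \<beta> = \<beta> ` critical_points E \<beta>"

definition toroidal_belyi_pair :: "weierstrass \<Rightarrow> (point \<Rightarrow> P1) \<Rightarrow> bool" where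
  "toroidal_belyi_pair E \<beta> \<longleftrightarrow> elliptic_curve E \<and> nonconstant_meromorphic E \<beta> \<and>
     critical_values E \<beta> \<subseteq> {Fin 0, Fin 1, Infty}"

definition quasi_critical_points :: "weierstrass \<Rightarrow> (point \<Rightarrow> P1) \<Rightarrow> point set" where
  "quasi_critical_points E \<beta> = {P \<in> points E. \<beta> P \<in> {Fin 0, Fin 1, Infty}}"

end

theory Submission
  imports Defs
begin

text \<open>An isogeny \<open>\<psi>\<close> is unramified, so \<open>\<phi> \<circ> \<psi>\<close> has at \<open>P\<close> the ramification index of \<open>\<phi>\<close> at \<open>\<psi> P\<close>,
  and no new critical values arise. Unramifiedness follows by counting: all nonempty fibres of \<open>\<psi>\<close>
  are finite of the same cardinality, because translations are injective, whereas near a ramification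
  point some fibre would have an additional point. Since ramification is measured along
  arbitrary holomorphic parametrisations, charts of the curve are needed through which every
  such parametrisation factors.

  The quasi-critical points of \<open>\<phi> \<circ> \<psi>\<close> are the preimage of those of \<open>\<phi>\<close>. If \<open>\<psi> P\<close> is torsion, the
  multiples of \<open>P\<close> lie in finitely many finite fibres, so two of them agree. Associativity of the
  group law is never needed, only the cancellation law \<open>A + P = B + P \<Longrightarrow> A = B\<close>.\<close>


section \<open>The chord-tangent law\<close>

text \<open>The global arguments rest on one identity principle: a form with infinitely many zeros
  on the curve vanishes on all of it. Lying in a given fibre of a morphism is expressed by vanishing
  2x2 minors built from forms, so the principle makes fibres of non-constant morphisms finite. This
  finiteness isolates the zeros of local expressions, makes fibres comparable by cardinality, and,
  since a chart puts infinitely many points on the curve, keeps the composite non-constant. A second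
  obstacle is that \<open>ramification_index\<close> is a definite description over all
  parametrisations: before two indices can be compared, the order of vanishing has to be shown
  finite, positive and independent of the parametrisation. After that a single well-chosen
  parametrisation at each point suffices. The counting argument compares the fibre over a nearby
  value with the fibre through the supposed ramification point, so one injective map between fibres
  settles it.\<close>

lemma Aff_in_points:
  "Aff x y \<in> points E \<longleftrightarrow>
     y\<^sup>2 + a\<^sub>1 E * x * y + a\<^sub>3 E * y = x^3 + a\<^sub>2 E * x\<^sup>2 + a\<^sub>4 E * x + a\<^sub>6 E"
  by (auto simp: points_def)

lemma O_pt_in_points [simp]: "O_pt \<in> points E"
  by (simp add: points_def)

lemma ec_neg_ec_neg [simp]: "ec_neg E (ec_neg E P) = P"
  by (cases P) auto

lemma ec_neg_eq_iff [simp]: "ec_neg E P = ec_neg E Q \<longleftrightarrow> P = Q"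
  by (metis ec_neg_ec_neg)

lemma ec_neg_in_points [simp]: "ec_neg E P \<in> points E \<longleftrightarrow> P \<in> points E"
proof (cases P)
  case (Aff x y)
  then show ?thesis
    by (simp add: Aff_in_points power2_eq_square algebra_simps)
qed simp

lemma ec_add_O_pt_right [simp]: "ec_add E P O_pt = P"
  by (cases P) auto

lemma ec_add_eq_O_pt_iff: "ec_add E P Q = O_pt \<longleftrightarrow> Q = ec_neg E P"
proof (cases P; cases Q)
  fix x y x' y'
  assume "P = Aff x y" "Q = Aff x' y'"
  then show ?thesis by (simp add: Let_def)
qed auto

text \<open>For fixed x the equation is quadratic in y with root sum
  \<open>- a\<^sub>1 E * x - a\<^sub>3 E\<close>; the difference of the two equations splits into
  linear factors.\<close>

lemma points_same_x:
  assumes "Aff x y1 \<in> points E" "Aff x y2 \<in> points E"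
  shows "y2 = y1 \<or> y2 = - y1 - a\<^sub>1 E * x - a\<^sub>3 E"
proof -
  have "(y2 - y1) * (y2 + y1 + a\<^sub>1 E * x + a\<^sub>3 E) = 0"
    using assms unfolding Aff_in_points by algebra
  then have "y2 - y1 = 0 \<or> y2 + y1 + a\<^sub>1 E * x + a\<^sub>3 E = 0"
    by (simp only: mult_eq_0_iff)
  moreover have "y2 + y1 + a\<^sub>1 E * x + a\<^sub>3 E = y2 - (- y1 - a\<^sub>1 E * x - a\<^sub>3 E)"
    by simp
  ultimately have "y2 - y1 = 0 \<or> y2 - (- y1 - a\<^sub>1 E * x - a\<^sub>3 E) = 0"
    by metis
  then show ?thesis
    by (simp only: right_minus_eq)
qed

text \<open>The last conclusion evaluates at \<open>x2\<close> the derivative of the cubic obtained by restricting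
  the equation to the line, whose roots are \<open>x1\<close>, \<open>x2\<close>, \<open>x3\<close>; for \<open>x3 = x2\<close> it says that the
  line is tangent at the second point.\<close>

lemma ec_add_Aff:
  assumes P: "Aff x1 y1 \<in> points E" and Q: "Aff x2 y2 \<in> points E"
    and ne: "Aff x2 y2 \<noteq> ec_neg E (Aff x1 y1)"
  obtains l x3 y3 where "ec_add E (Aff x1 y1) (Aff x2 y2) = ec_neg E (Aff x3 y3)"
    "x3 = l\<^sup>2 + a\<^sub>1 E * l - a\<^sub>2 E - x1 - x2" "y3 = y1 + l * (x3 - x1)" "y2 = y1 + l * (x2 - x1)"
    "(x2 - x1) * (x2 - x3) = 3 * x2\<^sup>2 + 2 * a\<^sub>2 E * x2 + a\<^sub>4 E - a\<^sub>1 E * y2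
       - l * (2 * y2 + a\<^sub>1 E * x2 + a\<^sub>3 E)"
proof -
  define l where "l = ec_slope E (x1, y1) (x2, y2)"
  define x3 where "x3 = l\<^sup>2 + a\<^sub>1 E * l - a\<^sub>2 E - x1 - x2"
  have add: "ec_add E (Aff x1 y1) (Aff x2 y2) = ec_neg E (Aff x3 (y1 + l * (x3 - x1)))"
    using ne by (simp add: Let_def l_def x3_def)
  have "y2 = y1 + l * (x2 - x1) \<and> (x2 - x1) * (x2 - x3) =
     3 * x2\<^sup>2 + 2 * a\<^sub>2 E * x2 + a\<^sub>4 E - a\<^sub>1 E * y2 - l * (2 * y2 + a\<^sub>1 E * x2 + a\<^sub>3 E)"
  proof (cases "x1 = x2")
    case True
    with P Q ne have y: "y2 = y1"
      using points_same_x by auto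
    \<comment> \<open>If this vanished, the point would be its own negative, contrary to
      \<open>ne\<close>: the tangent is not vertical.\<close>
    have nz: "2 * y2 + a\<^sub>1 E * x2 + a\<^sub>3 E \<noteq> 0"
    proof
      assume "2 * y2 + a\<^sub>1 E * x2 + a\<^sub>3 E = 0"
      then have "y1 = - y1 - a\<^sub>1 E * x1 - a\<^sub>3 E"
        unfolding y True by algebra
      then show False using ne True y by simp
    qed
    then have "l * (2 * y2 + a\<^sub>1 E * x2 + a\<^sub>3 E) = 3 * x2\<^sup>2 + 2 * a\<^sub>2 E * x2 + a\<^sub>4 E - a\<^sub>1 E * y2"
      unfolding l_def using True y by simp
    then show ?thesis using True y by simp
  next
    case False
    then have y: "y2 = y1 + l * (x2 - x1)"
      by (simp add: l_def)
    \<comment> \<open>The extra factor \<open>x2 - x1\<close> turns the claim into a polynomial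
      consequence of the two curve equations; it is cancelled afterwards.\<close>
    have "(x2 - x1) * ((x2 - x1) * (x2 - x3)) = (x2 - x1) *
     (3 * x2\<^sup>2 + 2 * a\<^sub>2 E * x2 + a\<^sub>4 E - a\<^sub>1 E * y2 - l * (2 * y2 + a\<^sub>1 E * x2 + a\<^sub>3 E))"
      using P Q y x3_def unfolding Aff_in_points by algebra
    then show ?thesis using y False by simp
  qed
  then show thesis using add x3_def that by blast
qed

lemma ec_add_in_points:
  assumes "P \<in> points E" "Q \<in> points E"
  shows "ec_add E P Q \<in> points E"
proof (cases "\<exists>x1 y1 x2 y2. P = Aff x1 y1 \<and> Q = Aff x2 y2 \<and> Aff x2 y2 \<noteq> ec_neg E (Aff x1 y1)")
  case True
  then obtain x1 y1 x2 y2 where eq: "P = Aff x1 y1" "Q = Aff x2 y2"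
    "Aff x2 y2 \<noteq> ec_neg E (Aff x1 y1)" by blast
  then obtain l x3 y3 where l: "ec_add E P Q = ec_neg E (Aff x3 y3)"
    "x3 = l\<^sup>2 + a\<^sub>1 E * l - a\<^sub>2 E - x1 - x2" "y3 = y1 + l * (x3 - x1)" "y2 = y1 + l * (x2 - x1)"
    "(x2 - x1) * (x2 - x3) = 3 * x2\<^sup>2 + 2 * a\<^sub>2 E * x2 + a\<^sub>4 E - a\<^sub>1 E * y2
       - l * (2 * y2 + a\<^sub>1 E * x2 + a\<^sub>3 E)"
    using ec_add_Aff assms by metis
  \<comment> \<open>The cubic on the line has root x2, root sum x1 + x2 + x3 and, by
    \<open>l(5)\<close>, derivative (x2 - x1)(x2 - x3) at x2, so x3 is a root. Using the derivative
    covers the chord and the tangent at once.\<close>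
  have "Aff x3 y3 \<in> points E"
    using l(2-5) assms unfolding eq Aff_in_points by algebra
  then show ?thesis by (simp only: l(1) ec_neg_in_points)
next
  case False
  then show ?thesis using assms
    by (cases P; cases Q) auto
qed

text \<open>If the line through \<open>A\<close> and \<open>P\<close> meets the curve again in \<open>R \<noteq> P\<close>, then its slope is that of
  \<open>PR\<close>; if \<open>R = P\<close>, it is the tangent at \<open>P\<close>. Thus \<open>P\<close> and \<open>R\<close> determine \<open>A\<close>.\<close>

lemma ec_add_right_cancel:
  assumes E: "elliptic_curve E" and pts: "A \<in> points E" "B \<in> points E" "P \<in> points E"
    and eq: "ec_add E A P = ec_add E B P"
  shows "A = B"
proof (cases P)
  case O_pt
  then show ?thesis using eq by simp
next
  case P: (Aff x2 y2)
  have nonsing: "\<not> (3 * x2\<^sup>2 + 2 * a\<^sub>2 E * x2 + a\<^sub>4 E - a\<^sub>1 E * y2 = 0 \<and> 2 * y2 + a\<^sub>1 E * x2 + a\<^sub>3 E = 0)"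
    using E pts(3) unfolding P elliptic_curve_def by (metis eq_iff_diff_eq_0)
  \<comment> \<open>The line through B and P would meet the curve again in - P. A non-vertical line
    has one point for each x, so - P = P and the y-derivative vanishes at P; \<open>l(5)\<close>
    with x3 = x2 then kills the x-derivative too, contradicting non-singularity.\<close>
  have no_fix: False if B: "B \<in> points E" "B \<noteq> O_pt" "ec_add E B P = P" for B
  proof -
    obtain x1 y1 where B': "B = Aff x1 y1" using B by (cases B) auto
    have "P \<noteq> ec_neg E B" using B P ec_add_eq_O_pt_iff by (metis point.distinct(1))
    then obtain l x3 y3 where l: "ec_add E B P = ec_neg E (Aff x3 y3)"
      "x3 = l\<^sup>2 + a\<^sub>1 E * l - a\<^sub>2 E - x1 - x2" "y3 = y1 + l * (x3 - x1)" "y2 = y1 + l * (x2 - x1)"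
      "(x2 - x1) * (x2 - x3) = 3 * x2\<^sup>2 + 2 * a\<^sub>2 E * x2 + a\<^sub>4 E - a\<^sub>1 E * y2
         - l * (2 * y2 + a\<^sub>1 E * x2 + a\<^sub>3 E)"
      using ec_add_Aff B pts(3) unfolding P B' by metis
    have x: "x3 = x2" and y: "y2 = - y3 - a\<^sub>1 E * x3 - a\<^sub>3 E" using l(1) B(3) P by auto
    have "y3 = y2" using l x by simp
    then have "y2 - (- y2 - a\<^sub>1 E * x2 - a\<^sub>3 E) = 0" using x y by simp
    then have "2 * y2 + a\<^sub>1 E * x2 + a\<^sub>3 E = 0" by (simp add: algebra_simps)
    then show False using nonsing l(5) x by simp
  qed
  consider "A = O_pt" | "B = O_pt" | x1 y1 x1' y1' where "A = Aff x1 y1" "B = Aff x1' y1'"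
    by (cases A; cases B) auto
  then show ?thesis
  proof cases
    case 1
    then show ?thesis using no_fix[of B] pts eq by (metis ec_add.simps(1))
  next
    case 2
    then show ?thesis using no_fix[of A] pts eq by (metis ec_add.simps(1))
  next
    case 3
    show ?thesis
    proof (cases "P = ec_neg E A")
      case True
      then have "P = ec_neg E B" using eq ec_add_eq_O_pt_iff by metis
      then show ?thesis using True by simp
    next
      case False
      then have "P \<noteq> ec_neg E B" using eq ec_add_eq_O_pt_iff by metis
      then obtain l x3 y3 where l: "ec_add E B P = ec_neg E (Aff x3 y3)"
        "x3 = l\<^sup>2 + a\<^sub>1 E * l - a\<^sub>2 E - x1' - x2" "y3 = y1' + l * (x3 - x1')" "y2 = y1' + l * (x2 - x1')"
        "(x2 - x1') * (x2 - x3) = 3 * x2\<^sup>2 + 2 * a\<^sub>2 E * x2 + a\<^sub>4 E - a\<^sub>1 E * y2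
           - l * (2 * y2 + a\<^sub>1 E * x2 + a\<^sub>3 E)"
        using ec_add_Aff pts unfolding P 3 by metis
      obtain l' x3' y3' where l': "ec_add E A P = ec_neg E (Aff x3' y3')"
        "x3' = l'\<^sup>2 + a\<^sub>1 E * l' - a\<^sub>2 E - x1 - x2" "y3' = y1 + l' * (x3' - x1)" "y2 = y1 + l' * (x2 - x1)"
        "(x2 - x1) * (x2 - x3') = 3 * x2\<^sup>2 + 2 * a\<^sub>2 E * x2 + a\<^sub>4 E - a\<^sub>1 E * y2
           - l' * (2 * y2 + a\<^sub>1 E * x2 + a\<^sub>3 E)"
        using False ec_add_Aff pts unfolding P 3 by metis
      have R: "x3' = x3" "y3' = y3"
        using l(1) l'(1) eq by (metis ec_neg_eq_iff point.inject)+
      have "l' = l"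
      proof (cases "x3 = x2")
        case True
        have nz: "2 * y2 + a\<^sub>1 E * x2 + a\<^sub>3 E \<noteq> 0"
          using nonsing l(5) True by auto
        have "l * (2 * y2 + a\<^sub>1 E * x2 + a\<^sub>3 E) = l' * (2 * y2 + a\<^sub>1 E * x2 + a\<^sub>3 E)"
          using l(5) l'(5) True R by simp
        then show ?thesis using nz by simp
      next
        case False
        have "l * (x3 - x2) = l' * (x3 - x2)"
          using l(3,4) l'(3,4) R by algebra
        then show ?thesis using False by simp
      qed
      then have "l\<^sup>2 + a\<^sub>1 E * l - a\<^sub>2 E - x1 - x2 = l\<^sup>2 + a\<^sub>1 E * l - a\<^sub>2 E - x1' - x2"
        using l(2) l'(2) R by metis
      then have "x1 = x1'" by simp
      moreover from this have "y1 = y1'" using l(4) l'(4) \<open>l' = l\<close> by simp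
      ultimately show ?thesis using 3 by simp
    qed
  qed
qed


section \<open>Forms on a Weierstrass curve\<close>

lemma form_monomial:
  assumes "i + j + k = d"
  shows "form d (\<lambda>v. b * (v $ 1) ^ i * (v $ 2) ^ j * (v $ 3) ^ k)"
  unfolding form_def
proof (intro exI allI)
  fix v :: "complex ^ 3"
  define c where "c = (\<lambda>i' j'. if i' = i \<and> j' = j then b else 0)"
  have "(\<Sum>i'\<le>d. \<Sum>j'\<le>d - i'. c i' j' * (v $ 1) ^ i' * (v $ 2) ^ j' * (v $ 3) ^ (d - i' - j'))
      = (\<Sum>i'\<le>d. if i' = i then b * (v $ 1) ^ i * (v $ 2) ^ j * (v $ 3) ^ (d - i - j) else 0)"
  proof (intro sum.cong refl)
    fix i' assume "i' \<in> {..d}"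
    show "(\<Sum>j'\<le>d - i'. c i' j' * (v $ 1) ^ i' * (v $ 2) ^ j' * (v $ 3) ^ (d - i' - j'))
      = (if i' = i then b * (v $ 1) ^ i * (v $ 2) ^ j * (v $ 3) ^ (d - i - j) else 0)"
    proof (cases "i' = i")
      case True
      have "(\<Sum>j'\<le>d - i'. c i' j' * (v $ 1) ^ i' * (v $ 2) ^ j' * (v $ 3) ^ (d - i' - j'))
         = (\<Sum>j'\<le>d - i. if j' = j then b * (v $ 1) ^ i * (v $ 2) ^ j * (v $ 3) ^ (d - i - j) else 0)"
        using True by (intro sum.cong) (auto simp: c_def)
      also have "\<dots> = b * (v $ 1) ^ i * (v $ 2) ^ j * (v $ 3) ^ (d - i - j)"
        using assms by auto
      finally show ?thesis using True by simp
    qed (simp add: c_def)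
  qed
  also have "\<dots> = b * (v $ 1) ^ i * (v $ 2) ^ j * (v $ 3) ^ (d - i - j)"
    using assms by auto
  also have "d - i - j = k" using assms by simp
  finally show "b * (v $ 1) ^ i * (v $ 2) ^ j * (v $ 3) ^ k =
      (\<Sum>i'\<le>d. \<Sum>j'\<le>d - i'. c i' j' * (v $ 1) ^ i' * (v $ 2) ^ j' * (v $ 3) ^ (d - i' - j'))" ..
qed

lemma form_add:
  assumes "form d F" "form d G"
  shows "form d (\<lambda>v. F v + G v)"
proof -
  obtain b c where *:
    "\<And>v. F v = (\<Sum>i\<le>d. \<Sum>j\<le>d - i. b i j * (v $ 1) ^ i * (v $ 2) ^ j * (v $ 3) ^ (d - i - j))"
    "\<And>v. G v = (\<Sum>i\<le>d. \<Sum>j\<le>d - i. c i j * (v $ 1) ^ i * (v $ 2) ^ j * (v $ 3) ^ (d - i - j))"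
    using assms unfolding form_def by blast
  show ?thesis
    unfolding form_def by (rule exI[of _ "\<lambda>i j. b i j + c i j"])
      (simp add: * algebra_simps flip: sum.distrib)
qed

lemma form_zero: "form d (\<lambda>v. 0)"
  unfolding form_def by (rule exI[of _ "\<lambda>_ _. 0"]) simp

lemma form_sum:
  assumes "\<And>i. i \<in> I \<Longrightarrow> form d (F i)"
  shows "form d (\<lambda>v. \<Sum>i\<in>I. F i v)"
proof (cases "finite I")
  case True
  then show ?thesis using assms
    by (induction I rule: finite_induct) (auto intro: form_zero form_add)
qed (simp add: form_zero)

text \<open>Expanding the product gives a sum of monomials of degree \<open>d + e\<close>, so
  closure under sums applies and no convolution of coefficients has to be written down.\<close>

lemma form_mult:
  assumes "form d F" "form e G"
  shows "form (d + e) (\<lambda>v. F v * G v)"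
proof -
  obtain b c where *:
    "\<And>v. F v = (\<Sum>i\<le>d. \<Sum>j\<le>d - i. b i j * (v $ 1) ^ i * (v $ 2) ^ j * (v $ 3) ^ (d - i - j))"
    "\<And>v. G v = (\<Sum>k\<le>e. \<Sum>l\<le>e - k. c k l * (v $ 1) ^ k * (v $ 2) ^ l * (v $ 3) ^ (e - k - l))"
    using assms unfolding form_def by blast
  have "F v * G v = (\<Sum>i\<le>d. \<Sum>j\<le>d - i. \<Sum>k\<le>e. \<Sum>l\<le>e - k.
      (b i j * c k l) * (v $ 1) ^ (i + k) * (v $ 2) ^ (j + l) * (v $ 3) ^ ((d - i - j) + (e - k - l)))" for v
  proof -
    have "F v * G v = (\<Sum>i\<le>d. \<Sum>j\<le>d - i. (b i j * (v $ 1) ^ i * (v $ 2) ^ j * (v $ 3) ^ (d - i - j)) * G v)"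
      by (simp only: *(1) sum_distrib_right)
    also have "\<dots> = (\<Sum>i\<le>d. \<Sum>j\<le>d - i. \<Sum>k\<le>e. \<Sum>l\<le>e - k.
        (b i j * (v $ 1) ^ i * (v $ 2) ^ j * (v $ 3) ^ (d - i - j)) *
        (c k l * (v $ 1) ^ k * (v $ 2) ^ l * (v $ 3) ^ (e - k - l)))"
      by (simp only: *(2) sum_distrib_left)
    also have "\<dots> = (\<Sum>i\<le>d. \<Sum>j\<le>d - i. \<Sum>k\<le>e. \<Sum>l\<le>e - k.
      (b i j * c k l) * (v $ 1) ^ (i + k) * (v $ 2) ^ (j + l) * (v $ 3) ^ ((d - i - j) + (e - k - l)))"
      by (intro sum.cong refl) (simp only: power_add mult_ac)
    finally show ?thesis .
  qed
  then have "(\<lambda>v. F v * G v) = (\<lambda>v. \<Sum>i\<le>d. \<Sum>j\<le>d - i. \<Sum>k\<le>e. \<Sum>l\<le>e - k.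
      (b i j * c k l) * (v $ 1) ^ (i + k) * (v $ 2) ^ (j + l) * (v $ 3) ^ ((d - i - j) + (e - k - l)))"
    by blast
  moreover have "form (d + e) \<dots>"
    by (intro form_sum form_monomial) auto
  ultimately show ?thesis by simp
qed

lemma form_const: "form 0 (\<lambda>v. b)"
  unfolding form_def by (rule exI[of _ "\<lambda>_ _. b"]) simp

lemma form_cmult: "form d F \<Longrightarrow> form d (\<lambda>v. b * F v)"
  using form_mult[OF form_const] by simp

lemma form_diff: "form d F \<Longrightarrow> form d G \<Longrightarrow> form d (\<lambda>v. F v - G v)"
  using form_add[of d F "\<lambda>v. (-1) * G v"] form_cmult[of d G "-1"] by simp

lemma form_power:
  assumes "form d F"
  shows "form (d * n) (\<lambda>v. F v ^ n)"
proof (induction n)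
  case 0
  then show ?case by (simp add: form_const)
next
  case (Suc n)
  then show ?case using form_mult[OF assms Suc] by simp
qed

text \<open>The exponents in each monomial of \<open>H\<close> add up to \<open>e\<close>, so
  substitution gives products of degree \<open>d * e\<close>. This is what composes
  morphisms.\<close>

lemma form_compose:
  assumes H: "form e H" and F: "\<And>i. form d (F i)"
  shows "form (d * e) (\<lambda>v. H (\<chi> i. F i v))"
proof -
  obtain c where c:
    "\<And>v. H v = (\<Sum>i\<le>e. \<Sum>j\<le>e - i. c i j * (v $ 1) ^ i * (v $ 2) ^ j * (v $ 3) ^ (e - i - j))"
    using H unfolding form_def by blast
  have "form (d * e) (\<lambda>v. c i j * F 1 v ^ i * F 2 v ^ j * F 3 v ^ (e - i - j))"
    if "i \<le> e" "j \<le> e - i" for i j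
  proof -
    have "form (d * i + d * j + d * (e - i - j)) (\<lambda>v. c i j * F 1 v ^ i * F 2 v ^ j * F 3 v ^ (e - i - j))"
      by (intro form_mult form_cmult form_power F)
    moreover have "d * i + d * j + d * (e - i - j) = d * e"
      using that by (simp flip: distrib_left)
    ultimately show ?thesis by simp
  qed
  then show ?thesis
    unfolding c vec_lambda_beta by (intro form_sum) auto
qed

text \<open>Homogeneity lets values move between a lift and \<open>hcoords\<close>. Taken at
  \<open>b = 0\<close> it also separates the degrees: a form of degree 0 is constant, one of
  positive degree vanishes at the origin.\<close>

lemma form_scale:
  assumes "form d F"
  shows "F (b *s v) = b ^ d * F v"
proof -
  obtain c where c:
    "\<And>v. F v = (\<Sum>i\<le>d. \<Sum>j\<le>d - i. c i j * (v $ 1) ^ i * (v $ 2) ^ j * (v $ 3) ^ (d - i - j))"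
    using assms unfolding form_def by blast
  have "c i j * (b * v $ 1) ^ i * (b * v $ 2) ^ j * (b * v $ 3) ^ (d - i - j)
      = b ^ d * (c i j * (v $ 1) ^ i * (v $ 2) ^ j * (v $ 3) ^ (d - i - j))"
    if "i \<le> d" "j \<le> d - i" for i j
  proof -
    have "b ^ d = b ^ i * b ^ j * b ^ (d - i - j)"
      using that by (simp flip: power_add)
    then show ?thesis by (simp add: power_mult_distrib)
  qed
  then show ?thesis
    unfolding c sum_distrib_left vector_smult_component by (intro sum.cong refl) auto
qed

lemma form_holomorphic:
  assumes "form d F" "\<And>i. (\<lambda>t. u t $ i) holomorphic_on S"
  shows "(\<lambda>t. F (u t)) holomorphic_on S"
proof -
  obtain c where c:
    "\<And>v. F v = (\<Sum>i\<le>d. \<Sum>j\<le>d - i. c i j * (v $ 1) ^ i * (v $ 2) ^ j * (v $ 3) ^ (d - i - j))"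
    using assms unfolding form_def by blast
  show ?thesis unfolding c by (intro holomorphic_intros assms)
qed

text \<open>In the coordinate ring \<open>\<complex>[x, y]\<close> of the affine curve every element is \<open>A(x) + B(x) y\<close>.\<close>

definition affine_regular :: "weierstrass \<Rightarrow> (complex \<Rightarrow> complex \<Rightarrow> complex) \<Rightarrow> bool" where
  "affine_regular E f \<longleftrightarrow> (\<exists>A B. \<forall>x y. Aff x y \<in> points E \<longrightarrow> f x y = poly A x + poly B x * y)"

lemma affine_regular_poly: "affine_regular E (\<lambda>x y. poly A x)"
  unfolding affine_regular_def by (rule exI[of _ A], rule exI[of _ 0]) simp

lemma affine_regular_y: "affine_regular E (\<lambda>x y. y)"
  unfolding affine_regular_def by (rule exI[of _ 0], rule exI[of _ 1]) simp

lemma affine_regular_add: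
  assumes "affine_regular E f" "affine_regular E g"
  shows "affine_regular E (\<lambda>x y. f x y + g x y)"
proof -
  obtain A B C D where "\<And>x y. Aff x y \<in> points E \<Longrightarrow> f x y = poly A x + poly B x * y"
    "\<And>x y. Aff x y \<in> points E \<Longrightarrow> g x y = poly C x + poly D x * y"
    using assms unfolding affine_regular_def by blast
  then show ?thesis
    unfolding affine_regular_def
    by (intro exI[of _ "A + C"] exI[of _ "B + D"]) (simp add: algebra_simps)
qed

text \<open>The relation y^2 = p(x) - q(x) y eliminates the only quadratic term B D y^2, which
  contributes B D p to the first part and - B D q to the coefficient of y.\<close>

lemma affine_regular_mult:
  assumes "affine_regular E f" "affine_regular E g"
  shows "affine_regular E (\<lambda>x y. f x y * g x y)"
proof -
  obtain A B C D where *: "\<And>x y. Aff x y \<in> points E \<Longrightarrow> f x y = poly A x + poly B x * y"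
    "\<And>x y. Aff x y \<in> points E \<Longrightarrow> g x y = poly C x + poly D x * y"
    using assms unfolding affine_regular_def by blast
  define p where "p = [:a\<^sub>6 E, a\<^sub>4 E, a\<^sub>2 E, 1:]"
  define q where "q = [:a\<^sub>3 E, a\<^sub>1 E:]"
  have "f x y * g x y = poly (A * C + B * D * p) x + poly (A * D + B * C - B * D * q) x * y"
    if P: "Aff x y \<in> points E" for x y
  proof -
    have "y * y = poly p x - poly q x * y"
      using P unfolding Aff_in_points by (simp add: p_def q_def power2_eq_square power3_eq_cube algebra_simps)
    then have "(poly A x + poly B x * y) * (poly C x + poly D x * y) =
      poly A x * poly C x + poly B x * poly D x * poly p x
        + (poly A x * poly D x + poly B x * poly C x - poly B x * poly D x * poly q x) * y"
      by algebra
    then show ?thesis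
      by (simp add: *[OF P])
  qed
  then show ?thesis
    unfolding affine_regular_def by blast
qed

lemma affine_regular_power: "affine_regular E f \<Longrightarrow> affine_regular E (\<lambda>x y. f x y ^ n)"
  by (induction n) (use affine_regular_poly[of E 1] in \<open>auto intro: affine_regular_mult\<close>)

lemma affine_regular_sum:
  assumes "\<And>i. i \<in> I \<Longrightarrow> affine_regular E (f i)"
  shows "affine_regular E (\<lambda>x y. \<Sum>i\<in>I. f i x y)"
proof (cases "finite I")
  case True
  then show ?thesis using assms
    by (induction I rule: finite_induct)
      (use affine_regular_poly[of E 0] in \<open>auto intro: affine_regular_add\<close>)
qed (use affine_regular_poly[of E 0] in simp)

lemma form_affine_regular:
  assumes "form d F"
  shows "affine_regular E (\<lambda>x y. F (hcoords (Aff x y)))"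
proof -
  obtain c where c:
    "\<And>v. F v = (\<Sum>i\<le>d. \<Sum>j\<le>d - i. c i j * (v $ 1) ^ i * (v $ 2) ^ j * (v $ 3) ^ (d - i - j))"
    using assms unfolding form_def by blast
  have "affine_regular E (\<lambda>x y. \<Sum>i\<le>d. \<Sum>j\<le>d - i. poly [:c i j:] x * poly [:0, 1:] x ^ i * y ^ j)"
    by (intro affine_regular_sum affine_regular_mult affine_regular_power affine_regular_poly affine_regular_y)
  then show ?thesis
    by (simp add: c)
qed

text \<open>The norm of \<open>A + B y\<close> is a polynomial in \<open>x\<close>; if it vanishes identically, then \<open>C\<^sup>2 = B\<^sup>2 D\<close>
  with \<open>D\<close> of degree \<open>3\<close>, which forces \<open>B = 0\<close> by parity of degrees.\<close>

lemma form_zero_on_affine: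
  assumes "form d F" and inf: "infinite {P \<in> points E. F (hcoords P) = 0}"
    and P: "Aff x y \<in> points E"
  shows "F (hcoords (Aff x y)) = 0"
proof -
  obtain A B where AB: "\<And>x y. Aff x y \<in> points E \<Longrightarrow> F (hcoords (Aff x y)) = poly A x + poly B x * y"
    using form_affine_regular[OF assms(1)] unfolding affine_regular_def by blast
  define p where "p = [:a\<^sub>6 E, a\<^sub>4 E, a\<^sub>2 E, 1:]"
  define q where "q = [:a\<^sub>3 E, a\<^sub>1 E:]"
  \<comment> \<open>This is (A + B y)(A + B y'), where y' is the second root over the same x: y + y'
    = - q and y y' = - p.\<close>
  define N where "N = A * A - A * B * q - B * B * p"
  define Z where "Z = {(x, y). Aff x y \<in> points E \<and> F (hcoords (Aff x y)) = 0}"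
  have pq: "y * y + poly q x * y = poly p x" if "Aff x y \<in> points E" for x y
    using that unfolding Aff_in_points
    by (simp add: p_def q_def power2_eq_square power3_eq_cube algebra_simps)
  have "{P \<in> points E. F (hcoords P) = 0} \<subseteq> insert O_pt ((\<lambda>(x, y). Aff x y) ` Z)"
  proof
    fix P assume "P \<in> {P \<in> points E. F (hcoords P) = 0}"
    then show "P \<in> insert O_pt ((\<lambda>(x, y). Aff x y) ` Z)"
      by (cases P) (auto simp: Z_def)
  qed
  then have infZ: "infinite Z"
    using inf finite_subset by (metis finite_imageI finite_insert)
  have fst: "poly N x = 0" if "(x, y) \<in> Z" for x y
  proof -
    have 1: "Aff x y \<in> points E" and "F (hcoords (Aff x y)) = 0"
      using that by (auto simp: Z_def)
    then have "poly A x + poly B x * y = 0" using AB by metis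
    then have "poly A x * poly A x - poly A x * poly B x * poly q x - poly B x * poly B x * poly p x = 0"
      using pq[OF 1] by algebra
    then show ?thesis by (simp add: N_def)
  qed
  have fin: "finite {y. Aff x y \<in> points E}" for x
  proof (cases "\<exists>y. Aff x y \<in> points E")
    case True
    then obtain y where y: "Aff x y \<in> points E" by blast
    have "{y. Aff x y \<in> points E} \<subseteq> {y, - y - a\<^sub>1 E * x - a\<^sub>3 E}"
      using points_same_x[OF y] by blast
    then show ?thesis by (rule finite_subset) simp
  qed simp
  have "N = 0"
  proof (rule ccontr)
    assume "N \<noteq> 0"
    then have "finite {x. poly N x = 0}" by (rule poly_roots_finite)
    then have "finite (SIGMA x:{x. poly N x = 0}. {y. Aff x y \<in> points E})"
      using fin by blast
    moreover have "Z \<subseteq> (SIGMA x:{x. poly N x = 0}. {y. Aff x y \<in> points E})"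
      using fst by (auto simp: Z_def)
    ultimately show False using infZ finite_subset by blast
  qed
  \<comment> \<open>Completing the square: 4 N = C^2 - B^2 D, with D the discriminant of y^2 + q y -
    p.\<close>
  define C where "C = [:2:] * A - B * q"
  define D where "D = [:4:] * p + q * q"
  have CD: "C * C = B * B * D"
  proof -
    have "poly (C * C - B * B * D) = poly ([:4:] * N)"
      by (rule ext) (simp add: C_def D_def N_def algebra_simps)
    then have "C * C - B * B * D = [:4:] * N"
      by (simp only: poly_eq_poly_eq_iff)
    then show ?thesis using \<open>N = 0\<close> by simp
  qed
  have D: "degree D = 3" "D \<noteq> 0"
    by (simp_all add: D_def p_def q_def)
  have "B = 0"
  proof (rule ccontr)
    assume B: "B \<noteq> 0"
    then have "C \<noteq> 0" using CD D by auto
    then have "degree C + degree C = degree B + degree B + 3"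
      using arg_cong[OF CD, of degree] B D by (simp add: degree_mult_eq)
    then show False by presburger
  qed
  then have "A = 0" using CD by (simp add: C_def)
  then show ?thesis using AB[OF P] \<open>B = 0\<close> by simp
qed


section \<open>Local charts\<close>

text \<open>\<open>A\<close> and \<open>B\<close> are divided differences of \<open>p\<close>; the solution is the fixed point of a contraction,
  and its difference quotient is \<open>- A / B\<close>.\<close>

lemma implicit_function:
  fixes p :: "complex \<Rightarrow> complex \<Rightarrow> complex"
    and A B :: "complex \<times> complex \<times> complex \<times> complex \<Rightarrow> complex"
  assumes dd: "\<And>s s' w w'. p s w - p s' w' = (s - s') * A (s, s', w, w') + (w - w') * B (s, s', w, w')"
    and contA: "continuous_on UNIV A" and contB: "continuous_on UNIV B"
    and p0: "p 0 0 = 0" and B0: "B (0, 0, 0, 0) \<noteq> 0"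
  obtains r e W where "0 < r" "0 < e" "W holomorphic_on ball 0 r" "W 0 = 0"
    "\<And>s. s \<in> ball 0 r \<Longrightarrow> p s (W s) = 0"
    "\<And>s w. s \<in> ball 0 r \<Longrightarrow> w \<in> ball 0 e \<Longrightarrow> p s w = 0 \<Longrightarrow> w = W s"
proof -
  define b where "b = B (0, 0, 0, 0)"
  define M where "M = norm (A (0, 0, 0, 0)) + 1"
  have b: "b \<noteq> 0" "norm b > 0" using B0 by (auto simp: b_def)
  have M: "M > 0" by (simp add: M_def add_nonneg_pos)
  have "\<forall>\<^sub>F z in nhds (0, 0, 0, 0). dist (B z) b < norm b / 2 \<and> dist (A z) (A (0, 0, 0, 0)) < 1"
  proof (intro eventually_conj)
    have "(B \<longlongrightarrow> b) (nhds (0, 0, 0, 0))" "(A \<longlongrightarrow> A (0, 0, 0, 0)) (nhds (0, 0, 0, 0))"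
      using contA contB unfolding b_def continuous_on_def by (metis UNIV_I tendsto_at_iff_tendsto_nhds)+
    then show "\<forall>\<^sub>F z in nhds (0, 0, 0, 0). dist (B z) b < norm b / 2"
      "\<forall>\<^sub>F z in nhds (0, 0, 0, 0). dist (A z) (A (0, 0, 0, 0)) < 1"
      using tendstoD b by (metis half_gt_zero, metis zero_less_one)
  qed
  then obtain \<delta> where \<delta>: "\<delta> > 0"
    "\<And>z. dist z (0, 0, 0, 0) < \<delta> \<Longrightarrow> dist (B z) b < norm b / 2 \<and> dist (A z) (A (0, 0, 0, 0)) < 1"
    unfolding eventually_nhds_metric by blast
  \<comment> \<open>The norm of a quadruple is at most the sum of its four entries' norms, hence the
    divisor 4.\<close>
  define \<eta> where "\<eta> = \<delta> / 4"
  have \<eta>: "\<eta> > 0" using \<delta> by (simp add: \<eta>_def)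
  have near: "norm (B (s, s', w, w') - b) < norm b / 2 \<and> norm (A (s, s', w, w')) \<le> M"
    if "norm s < \<eta>" "norm s' < \<eta>" "norm w < \<eta>" "norm w' < \<eta>" for s s' w w'
  proof -
    have "norm (s, s', w, w') \<le> norm s + (norm s' + (norm w + norm w'))"
      by (meson add_left_mono norm_Pair_le order_trans)
    also have "\<dots> < \<delta>" using that by (simp add: \<eta>_def)
    finally have "dist (s, s', w, w') (0, 0, 0, 0) < \<delta>"
      by (simp add: dist_norm)
    from \<delta>(2)[OF this] have *: "norm (B (s, s', w, w') - b) < norm b / 2"
        "norm (A (s, s', w, w') - A (0, 0, 0, 0)) < 1"
      by (simp_all add: dist_norm)
    have "norm (A (s, s', w, w')) \<le> norm (A (0, 0, 0, 0)) + norm (A (s, s', w, w') - A (0, 0, 0, 0))"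
      by (rule norm_triangle_sub)
    with * show ?thesis by (simp add: M_def)
  qed
  have B_nz: "norm (B (s, s', w, w')) \<ge> norm b / 2"
    if "norm s < \<eta>" "norm s' < \<eta>" "norm w < \<eta>" "norm w' < \<eta>" for s s' w w'
  proof -
    have "norm b \<le> norm (B (s, s', w, w')) + norm (b - B (s, s', w, w'))"
      by (rule norm_triangle_sub)
    then show ?thesis using near[OF that] by (simp add: norm_minus_commute)
  qed
  define e where "e = \<eta> / 2"
  \<comment> \<open>The bound gives |s| M / |b| <= e / 2, so \<open>T s 0\<close> stays within e /
    2; a contraction by 1/2 then keeps \<open>cball 0 e\<close> invariant.\<close>
  define r where "r = min \<eta> (e * norm b / (2 * M))"
  have e: "e > 0" "e < \<eta>" using \<eta> by (simp_all add: e_def)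
  have r: "r > 0" "r \<le> \<eta>" "r \<le> e * norm b / (2 * M)" using \<eta> e b M by (simp_all add: r_def)
  \<comment> \<open>A Newton step for \<open>p s\<close> with the slope frozen at \<open>b\<close>:
    its fixed points are the zeros of \<open>p s\<close>, and it contracts because \<open>B\<close>
    stays within |b| / 2 of \<open>b\<close>.\<close>
  define T where "T = (\<lambda>s w. w - p s w / b)"
  have contr: "norm (T s w - T s w') \<le> 1 / 2 * norm (w - w')"
    if "norm s < r" "norm w \<le> e" "norm w' \<le> e" for s w w'
  proof -
    have *: "norm (B (s, s, w, w') - b) < norm b / 2"
      using near that e r by simp
    have "p s w - p s w' = (w - w') * B (s, s, w, w')"
      using dd[of s w s w'] by simp
    then have "T s w - T s w' = (w - w') - (w - w') * B (s, s, w, w') / b"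
      unfolding T_def by (metis (no_types, lifting) add_diff_eq diff_add_eq diff_diff_eq2 diff_divide_distrib)
    also have "\<dots> = (w - w') * ((b - B (s, s, w, w')) / b)"
      using b by (simp add: field_simps)
    finally have "norm (T s w - T s w') = norm (w - w') * (norm (B (s, s, w, w') - b) / norm b)"
      by (simp add: norm_mult norm_divide norm_minus_commute)
    also have "\<dots> \<le> norm (w - w') * (1 / 2)"
      using * b by (intro mult_left_mono) (auto simp: field_simps)
    finally show ?thesis by simp
  qed
  have ex: "\<exists>!w. w \<in> cball 0 e \<and> T s w = w" if s: "norm s < r" for s
  proof (rule Banach_fix[where c = "1 / 2"])
    show "complete (cball (0::complex) e)" by (simp add: complete_eq_closed)
    show "T s ` cball 0 e \<subseteq> cball 0 e"
    proof (clarsimp)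
      fix w :: complex assume w: "norm w \<le> e"
      have "p s 0 = s * A (s, 0, 0, 0)" using dd[of s 0 0 0] p0 by simp
      then have "norm (T s 0) = norm s * norm (A (s, 0, 0, 0)) / norm b"
        by (simp add: T_def norm_mult norm_divide)
      also have "\<dots> \<le> (e * norm b / (2 * M)) * M / norm b"
        using near[of s 0 0 0] s r \<eta> b M e by (intro divide_right_mono mult_mono) auto
      also have "\<dots> = e / 2" using b M by simp
      finally have "norm (T s 0) \<le> e / 2" .
      moreover have "norm (T s w - T s 0) \<le> 1 / 2 * norm (w - 0)"
        using contr s w e by (metis less_eq_real_def norm_zero)
      moreover have "norm (T s w) \<le> norm (T s 0) + norm (T s w - T s 0)"
        by (rule norm_triangle_sub)
      ultimately show "norm (T s w) \<le> e" using w by simp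
    qed
    show "\<And>x y. x \<in> cball 0 e \<Longrightarrow> y \<in> cball 0 e \<Longrightarrow> dist (T s x) (T s y) \<le> 1 / 2 * dist x y"
      using contr s by (simp add: dist_norm)
  qed (use e in auto)
  define W where "W = (\<lambda>s. THE w. w \<in> cball 0 e \<and> T s w = w)"
  have W: "norm (W s) \<le> e" "T s (W s) = W s" if "norm s < r" for s
    using theI'[OF ex[OF that]] by (simp_all add: W_def)
  have W_unique: "w = W s" if "norm s < r" "norm w \<le> e" "p s w = 0" for s w
    using ex[OF that(1)] W[OF that(1)] that(2,3) by (auto simp: T_def)
  have pW: "p s (W s) = 0" if "norm s < r" for s
    using W(2)[OF that] b by (simp add: T_def)
  have W0: "W 0 = 0" using W_unique[of 0 0] r e p0 by simp
  have small: "norm s < \<eta>" "norm (W s) < \<eta>" if "norm s < r" for s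
    using W(1)[OF that] that r e by auto
  have diff: "(W s - W s') = - (s - s') * (A (s, s', W s, W s') / B (s, s', W s, W s'))"
    if "norm s < r" "norm s' < r" for s s'
  proof -
    have "B (s, s', W s, W s') \<noteq> 0"
      using B_nz[of s s' "W s" "W s'"] small that b by auto
    moreover have "(s - s') * A (s, s', W s, W s') + (W s - W s') * B (s, s', W s, W s') = 0"
      using dd[of s "W s" s' "W s'"] pW that by simp
    ultimately show ?thesis by (simp add: field_simps eq_neg_iff_add_eq_0)
  qed
  \<comment> \<open>Continuity of \<open>W\<close> has to come before differentiability, because the
    difference quotient in \<open>diff\<close> itself contains \<open>W\<close>.\<close>
  have lip: "norm (W s - W s') \<le> (2 * M / norm b) * norm (s - s')"
    if "norm s < r" "norm s' < r" for s s'
  proof -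
    have "norm (W s - W s') = norm (s - s') * (norm (A (s, s', W s, W s')) / norm (B (s, s', W s, W s')))"
      unfolding diff[OF that] by (simp only: norm_mult norm_divide norm_minus_cancel)
    also have "\<dots> \<le> norm (s - s') * (M / (norm b / 2))"
      using near[of s s' "W s" "W s'"] B_nz[of s s' "W s" "W s'"] small that b M
      by (intro mult_left_mono frac_le) auto
    finally show ?thesis by (simp add: mult_ac)
  qed
  have "W holomorphic_on ball 0 r"
  proof (rule holomorphic_onI)
    fix s' :: complex assume "s' \<in> ball 0 r"
    then have s': "norm s' < r" by simp
    have ev: "\<forall>\<^sub>F s in at s'. norm s < r"
      using s' eventually_at_in_open'[of "ball 0 r" s'] by (auto elim: eventually_mono)
    have contW: "(W \<longlongrightarrow> W s') (at s')"
    proof (rule LIM_zero_cancel, rule Lim_null_comparison)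
      show "\<forall>\<^sub>F s in at s'. norm (W s - W s') \<le> (2 * M / norm b) * norm (s - s')"
        using ev by eventually_elim (use lip s' in auto)
      show "((\<lambda>s. (2 * M / norm b) * norm (s - s')) \<longlongrightarrow> 0) (at s')"
        by (rule tendsto_eq_intros refl | simp)+
    qed
    let ?q = "\<lambda>s. (s, s', W s, W s')"
    have q: "(?q \<longlongrightarrow> (s', s', W s', W s')) (at s')"
      by (intro tendsto_Pair tendsto_const tendsto_ident_at contW)
    have "((\<lambda>s. A (?q s)) \<longlongrightarrow> A (s', s', W s', W s')) (at s')"
      "((\<lambda>s. B (?q s)) \<longlongrightarrow> B (s', s', W s', W s')) (at s')"
      using contA contB q by (auto intro: continuous_on_tendsto_compose)
    moreover have "B (s', s', W s', W s') \<noteq> 0"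
      using B_nz[of s' s' "W s'" "W s'"] small s' b by auto
    ultimately have "((\<lambda>s. - (A (?q s) / B (?q s))) \<longlongrightarrow> - (A (s', s', W s', W s') / B (s', s', W s', W s'))) (at s')"
      by (intro tendsto_intros)
    moreover have "\<forall>\<^sub>F s in at s'. - (A (?q s) / B (?q s)) = (W s - W s') / (s - s')"
    proof -
      have "\<forall>\<^sub>F s in at s'. s \<noteq> s'" by (simp add: eventually_at_filter)
      with ev show ?thesis
      proof eventually_elim
        case (elim s)
        have "- q = (- d * q) / d" if "d \<noteq> 0" for q d :: complex
          using that by simp
        then show ?case
          using elim(2) unfolding diff[OF elim(1) s'] by (metis right_minus_eq)
      qed
    qed
    ultimately have "((\<lambda>s. (W s - W s') / (s - s')) \<longlongrightarrow> - (A (s', s', W s', W s') / B (s', s', W s', W s'))) (at s')"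
      by (rule Lim_transform_eventually)
    then have "(W has_field_derivative - (A (s', s', W s', W s') / B (s', s', W s', W s'))) (at s')"
      by (simp add: has_field_derivative_iff)
    then show "W field_differentiable at s' within ball 0 r"
      using field_differentiable_at_within field_differentiable_def by blast
  qed
  then show thesis
    by (intro that[of r e W]) (use r(1) e(1) W0 pW W_unique in auto)
qed

section \<open>The cone over the curve, holomorphic discs in it, and charts\<close>

definition wform :: "weierstrass \<Rightarrow> complex ^ 3 \<Rightarrow> complex" where
  "wform E v = (v $ 2)\<^sup>2 * v $ 3 + a\<^sub>1 E * v $ 1 * v $ 2 * v $ 3 + a\<^sub>3 E * v $ 2 * (v $ 3)\<^sup>2
     - ((v $ 1) ^ 3 + a\<^sub>2 E * (v $ 1)\<^sup>2 * v $ 3 + a\<^sub>4 E * v $ 1 * (v $ 3)\<^sup>2 + a\<^sub>6 E * (v $ 3) ^ 3)"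

text \<open>On the cone over a Weierstrass curve a vanishing third coordinate forces the first to
  vanish as well, so the value \<open>O_pt\<close> is the correct point there and not merely a
  default.\<close>

definition proj_pt :: "complex ^ 3 \<Rightarrow> point" where
  "proj_pt v = (if v $ 3 = 0 then O_pt else Aff (v $ 1 / v $ 3) (v $ 2 / v $ 3))"

definition proj_curve :: "weierstrass \<Rightarrow> (complex ^ 3) set" where
  "proj_curve E = {v. v \<noteq> 0 \<and> wform E v = 0}"

lemma wform_scale: "wform E (c *s v) = c ^ 3 * wform E v"
  by (simp add: wform_def power2_eq_square power3_eq_cube algebra_simps)

lemma hcoords_nz [simp]: "hcoords P \<noteq> 0"
  by (cases P) (auto simp: vec_eq_iff forall_3)

lemma hcoords_in_proj_curve_iff: "hcoords P \<in> proj_curve E \<longleftrightarrow> P \<in> points E"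
proof (cases P)
  case (Aff x y)
  then show ?thesis
    using hcoords_nz[of P] by (simp add: proj_curve_def wform_def Aff_in_points)
next
  case O_pt
  then show ?thesis
    using hcoords_nz[of P] by (simp add: proj_curve_def wform_def)
qed

lemma scale_in_proj_curve_iff: "c \<noteq> 0 \<Longrightarrow> c *s v \<in> proj_curve E \<longleftrightarrow> v \<in> proj_curve E"
  by (simp add: proj_curve_def wform_scale)

lemma proj_pt_scale [simp]: "c \<noteq> 0 \<Longrightarrow> proj_pt (c *s v) = proj_pt v"
  by (simp add: proj_pt_def)

lemma proj_pt_hcoords [simp]: "proj_pt (hcoords P) = P"
  by (cases P) (auto simp: proj_pt_def)

lemma proj_curve_eq_hcoords:
  assumes "v \<in> proj_curve E"
  obtains c where "c \<noteq> 0" "v = c *s hcoords (proj_pt v)"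
proof (cases "v $ 3 = 0")
  case True
  with assms have "v $ 1 = 0" "v $ 2 \<noteq> 0"
    by (auto simp: proj_curve_def wform_def vec_eq_iff forall_3)
  with True that[of "v $ 2"] show thesis
    by (simp add: vec_eq_iff forall_3 proj_pt_def)
next
  case False
  with that[of "v $ 3"] show thesis
    by (simp add: vec_eq_iff forall_3 proj_pt_def)
qed

lemma proj_pt_in_points:
  assumes "v \<in> proj_curve E"
  shows "proj_pt v \<in> points E"
  using assms proj_curve_eq_hcoords scale_in_proj_curve_iff hcoords_in_proj_curve_iff by metis

lemma proj_pt_eqD:
  assumes "v \<in> proj_curve E" "w \<in> proj_curve E" "proj_pt v = proj_pt w"
  obtains c where "c \<noteq> 0" "v = c *s w"
proof -
  obtain a where a: "a \<noteq> 0" "v = a *s hcoords (proj_pt v)"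
    using assms(1) by (rule proj_curve_eq_hcoords)
  obtain b where b: "b \<noteq> 0" "w = b *s hcoords (proj_pt w)"
    using assms(2) by (rule proj_curve_eq_hcoords)
  have "(a / b) *s w = (a / b) *s (b *s hcoords (proj_pt w))"
    using b(2) by simp
  also have "\<dots> = v" using a b(1) assms(3) by simp
  finally show thesis using that[of "a / b"] a(1) b(1) by simp
qed

text \<open>Discs are taken in the cone inside \<complex>^3, where holomorphy is a condition on
  coordinates; \<open>proj_pt\<close> recovers the points of the curve.\<close>

definition lifted_disc :: "weierstrass \<Rightarrow> real \<Rightarrow> (complex \<Rightarrow> complex ^ 3) \<Rightarrow> bool" where
  "lifted_disc E r u \<longleftrightarrow> r > 0 \<and> (\<forall>i. (\<lambda>t. u t $ i) holomorphic_on ball 0 r)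
     \<and> (\<forall>t \<in> ball 0 r. u t \<in> proj_curve E)"

definition immersive :: "(complex \<Rightarrow> complex ^ 3) \<Rightarrow> bool" where
  "immersive u \<longleftrightarrow> (\<nexists>c. (\<chi> i. deriv (\<lambda>t. u t $ i) 0) = c *s u 0)"

text \<open>The unknown scalar between \<open>u t\<close> and \<open>hcoords (\<gamma> t)\<close>
  disappears: for a lift in the cone, \<gamma> is determined by \<open>u\<close> through
  \<open>proj_pt\<close>.\<close>

lemma local_param_iff:
  "local_param E P \<gamma> \<longleftrightarrow>
     \<gamma> 0 = P \<and> (\<exists>r u. lifted_disc E r u \<and> immersive u \<and> (\<forall>t \<in> ball 0 r. \<gamma> t = proj_pt (u t)))"
proof -
  have "\<gamma> t \<in> points E \<and> (\<exists>c. c \<noteq> 0 \<and> u t = c *s hcoords (\<gamma> t)) \<longleftrightarrow>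
        u t \<in> proj_curve E \<and> \<gamma> t = proj_pt (u t)" for u t
    by (metis hcoords_in_proj_curve_iff proj_curve_eq_hcoords proj_pt_hcoords proj_pt_in_points
        proj_pt_scale scale_in_proj_curve_iff)
  then show ?thesis
    unfolding local_param_def lifted_disc_def immersive_def by (simp add: ball_conj_distrib) blast
qed

text \<open>The last clause is a universal property. It covers all discs through \<open>Q\<close>,
  immersive or not, because it is applied to the image of a disc under \<psi>, whose immersivity is
  the question; the derivative of the transition map \<open>h\<close> decides it.\<close>

definition chart_at :: "weierstrass \<Rightarrow> point \<Rightarrow> real \<Rightarrow> (complex \<Rightarrow> complex ^ 3) \<Rightarrow> bool" where
  "chart_at E Q r u0 \<longleftrightarrow> lifted_disc E r u0 \<and> immersive u0 \<and> proj_pt (u0 0) = Q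
     \<and> inj_on (\<lambda>t. proj_pt (u0 t)) (ball 0 r)
     \<and> (\<forall>u s. lifted_disc E s u \<longrightarrow> proj_pt (u 0) = Q \<longrightarrow>
         (\<exists>s' h. 0 < s' \<and> s' \<le> s \<and> h holomorphic_on ball 0 s' \<and> h 0 = 0 \<and> h ` ball 0 s' \<subseteq> ball 0 r
           \<and> (\<forall>t \<in> ball 0 s'. proj_pt (u t) = proj_pt (u0 (h t))) \<and> (immersive u \<longleftrightarrow> deriv h 0 \<noteq> 0)))"

lemma chart_atD:
  assumes "chart_at E Q r u0"
  shows "lifted_disc E r u0" "immersive u0" "proj_pt (u0 0) = Q"
    "inj_on (\<lambda>t. proj_pt (u0 t)) (ball 0 r)"
  using assms by (simp_all add: chart_at_def)

lemma chart_at_factor: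
  assumes "chart_at E Q r u0" "lifted_disc E s u" "proj_pt (u 0) = Q"
  obtains s' h where "0 < s'" "s' \<le> s" "h holomorphic_on ball 0 s'" "h 0 = 0" "h ` ball 0 s' \<subseteq> ball 0 r"
    "\<And>t. t \<in> ball 0 s' \<Longrightarrow> proj_pt (u t) = proj_pt (u0 (h t))" "immersive u \<longleftrightarrow> deriv h 0 \<noteq> 0"
proof -
  have "\<forall>u s. lifted_disc E s u \<longrightarrow> proj_pt (u 0) = Q \<longrightarrow>
         (\<exists>s' h. 0 < s' \<and> s' \<le> s \<and> h holomorphic_on ball 0 s' \<and> h 0 = 0 \<and> h ` ball 0 s' \<subseteq> ball 0 r
           \<and> (\<forall>t \<in> ball 0 s'. proj_pt (u t) = proj_pt (u0 (h t))) \<and> (immersive u \<longleftrightarrow> deriv h 0 \<noteq> 0))"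
    using assms(1) unfolding chart_at_def by (elim conjE)
  from this[rule_format, OF assms(2,3)] show thesis
    by (elim exE conjE) (rule that, assumption+, erule (1) bspec, assumption)
qed

text \<open>Homogeneous coordinates are normalised by the \<open>k\<close>-th one; the \<open>i\<close>-th one is the parameter and
  the \<open>j\<close>-th one is solved for.\<close>

lemma chart_at_in_coordinates:
  fixes i j k :: 3 and v :: "complex ^ 3"
  defines "P \<equiv> (\<lambda>s w. \<chi> m. if m = i then v $ i + s else if m = j then v $ j + w else 1)"
  assumes ijk: "i \<noteq> j" "i \<noteq> k" "j \<noteq> k" and v: "v $ k = 1" "wform E v = 0"
    and dd: "\<And>s s' w w'. wform E (P s w) - wform E (P s' w')
               = (s - s') * A (s, s', w, w') + (w - w') * B (s, s', w, w')"
    and contA: "continuous_on UNIV A" and contB: "continuous_on UNIV B"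
    and B0: "B (0, 0, 0, 0) \<noteq> 0"
  obtains r u0 where "chart_at E (proj_pt v) r u0"
proof -
  have UN: "m = i \<or> m = j \<or> m = k" for m
    using ijk by (metis (full_types) exhaust_3)
  have P00: "P 0 0 = v"
    unfolding P_def vec_eq_iff using UN v by force
  obtain r e W where W: "0 < r" "0 < e" "W holomorphic_on ball 0 r" "W 0 = 0"
    "\<And>s. s \<in> ball 0 r \<Longrightarrow> wform E (P s (W s)) = 0"
    "\<And>s w. s \<in> ball 0 r \<Longrightarrow> w \<in> ball 0 e \<Longrightarrow> wform E (P s w) = 0 \<Longrightarrow> w = W s"
    by (rule implicit_function[of "\<lambda>s w. wform E (P s w)", OF dd contA contB _ B0])
      (auto simp: P00 v)
  define u0 where "u0 = (\<lambda>s. P s (W s))"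
  have u0_i: "u0 s $ i = v $ i + s" and u0_j: "u0 s $ j = v $ j + W s" and u0_k: "u0 s $ k = 1" for s
    using ijk by (auto simp: u0_def P_def)
  have u00: "u0 0 = v" by (simp add: u0_def W(4) P00)
  have hol0: "(\<lambda>t. u0 t $ m) holomorphic_on ball 0 r" for m
    using UN[of m] by (auto simp: u0_i u0_j u0_k intro!: holomorphic_intros W)
  have cur0: "u0 s \<in> proj_curve E" if "s \<in> ball 0 r" for s
  proof -
    have "u0 s \<noteq> 0" using u0_k[of s] by auto
    then show ?thesis using W(5)[OF that] by (simp add: proj_curve_def u0_def)
  qed
  have disc: "lifted_disc E r u0"
    using W(1) hol0 cur0 by (auto simp: lifted_disc_def)
  have d_i: "deriv (\<lambda>t. u0 t $ i) 0 = 1" and d_k: "deriv (\<lambda>t. u0 t $ k) 0 = 0"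
    by (simp_all add: u0_i u0_k)
  \<comment> \<open>The k-th coordinate is constantly 1, which forces a factor of proportionality 0,
    whereas the i-th coordinate has derivative 1.\<close>
  have imm: "immersive u0"
    unfolding immersive_def
  proof
    assume "\<exists>c. (\<chi> i. deriv (\<lambda>t. u0 t $ i) 0) = c *s u0 0"
    then obtain c where "\<And>m. deriv (\<lambda>t. u0 t $ m) 0 = c * u0 0 $ m"
      by (auto simp: vec_eq_iff)
    from this[of i] this[of k] show False by (simp add: d_i d_k u0_k)
  qed
  have inj: "inj_on (\<lambda>t. proj_pt (u0 t)) (ball 0 r)"
  proof (rule inj_onI)
    fix s t assume "s \<in> ball 0 r" "t \<in> ball 0 r" "proj_pt (u0 s) = proj_pt (u0 t)"
    then obtain c where c: "u0 s = c *s u0 t"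
      using cur0 proj_pt_eqD by metis
    have "c = 1" using arg_cong[OF c, of "\<lambda>x. x $ k"] by (simp add: u0_k)
    then show "s = t" using arg_cong[OF c, of "\<lambda>x. x $ i"] by (simp add: u0_i)
  qed
  have fac: "\<exists>s' h. 0 < s' \<and> s' \<le> s \<and> h holomorphic_on ball 0 s' \<and> h 0 = 0 \<and> h ` ball 0 s' \<subseteq> ball 0 r
         \<and> (\<forall>t \<in> ball 0 s'. proj_pt (u t) = proj_pt (u0 (h t))) \<and> (immersive u \<longleftrightarrow> deriv h 0 \<noteq> 0)"
    if u: "lifted_disc E s u" "proj_pt (u 0) = proj_pt v" for u s
  proof -
    have s: "s > 0" and hol: "\<And>m. (\<lambda>t. u t $ m) holomorphic_on ball 0 s"
      and cur: "\<And>t. t \<in> ball 0 s \<Longrightarrow> u t \<in> proj_curve E"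
      using u(1) by (auto simp: lifted_disc_def)
    have "v \<in> proj_curve E" using cur0[of 0] W(1) u00 by simp
    then obtain c where c: "c \<noteq> 0" "u 0 = c *s v"
      using proj_pt_eqD[of "u 0" E v] cur[of 0] s u(2) by auto
    have uk0: "u 0 $ k = c" using c v by simp
    have lim: "((\<lambda>t. u t $ m) \<longlongrightarrow> u 0 $ m) (nhds 0)" for m
      using holomorphic_on_imp_continuous_on[OF hol[of m]] s
      by (metis centre_in_ball continuous_on_eq_continuous_at isCont_def open_ball tendsto_at_iff_tendsto_nhds)
    \<comment> \<open>\<open>h\<close> and \<open>g\<close> are the displacements from
      \<open>v\<close> of the i-th and j-th coordinates after scaling the k-th to 1. Near 0 the
      curve equation forces \<open>g t = W (h t)\<close>, so \<open>h\<close> is the transition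
      map.\<close>
    define h where "h = (\<lambda>t. u t $ i / u t $ k - v $ i)"
    define g where "g = (\<lambda>t. u t $ j / u t $ k - v $ j)"
    have h0: "h 0 = 0" and g0: "g 0 = 0"
      using c v by (simp_all add: h_def g_def)
    have "((\<lambda>t. u t $ m / u t $ k - v $ m) \<longlongrightarrow> u 0 $ m / u 0 $ k - v $ m) (nhds 0)" for m
      using c uk0 by (intro tendsto_intros lim) simp
    then have hg: "(h \<longlongrightarrow> h 0) (nhds 0)" "(g \<longlongrightarrow> g 0) (nhds 0)"
      unfolding h_def g_def by blast+
    have "\<forall>\<^sub>F t in nhds 0. h t \<in> ball 0 r" "\<forall>\<^sub>F t in nhds 0. g t \<in> ball 0 e"
      using topological_tendstoD[OF hg(1), of "ball 0 r"] topological_tendstoD[OF hg(2), of "ball 0 e"]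
        W(1,2) h0 g0 by auto
    moreover have "\<forall>\<^sub>F t in nhds 0. u t $ k \<noteq> 0"
      using tendsto_imp_eventually_ne[OF lim[of k]] uk0 c(1) by auto
    ultimately have "\<forall>\<^sub>F t in nhds 0. h t \<in> ball 0 r \<and> g t \<in> ball 0 e \<and> u t $ k \<noteq> 0"
      by eventually_elim auto
    then obtain d where d: "d > 0"
      "\<And>t. dist t 0 < d \<Longrightarrow> h t \<in> ball 0 r \<and> g t \<in> ball 0 e \<and> u t $ k \<noteq> 0"
      unfolding eventually_nhds_metric by blast
    define s' where "s' = min s d"
    have s': "s' > 0" "s' \<le> s" using s d by (auto simp: s'_def)
    have near: "h t \<in> ball 0 r" "g t \<in> ball 0 e" "u t $ k \<noteq> 0" "t \<in> ball 0 s" if "t \<in> ball 0 s'" for t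
      using d(2)[of t] that by (auto simp: s'_def)
    have fac: "u t = (u t $ k) *s u0 (h t)" if t: "t \<in> ball 0 s'" for t
    proof -
      have eq: "u t = (u t $ k) *s P (h t) (g t)"
        unfolding vec_eq_iff
      proof
        fix m
        show "u t $ m = ((u t $ k) *s P (h t) (g t)) $ m"
          using UN[of m] ijk near[OF t] by (auto simp: P_def h_def g_def)
      qed
      have "wform E (u t) = 0" using cur near t by (auto simp: proj_curve_def)
      then have "wform E (P (h t) (g t)) = 0"
        using eq wform_scale[of E "u t $ k" "P (h t) (g t)"] near[OF t] by auto
      then have "g t = W (h t)" using W(6) near[OF t] by blast
      with eq show ?thesis by (simp add: u0_def)
    qed
    have holh: "h holomorphic_on ball 0 s'"
      unfolding h_def using near s'
      by (intro holomorphic_intros holomorphic_on_subset[OF hol]) (auto simp: s'_def)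
    have proj: "proj_pt (u t) = proj_pt (u0 (h t))" if t: "t \<in> ball 0 s'" for t
      using fac[OF t] near[OF t] proj_pt_scale by metis
    define a where "a = deriv (\<lambda>t. u t $ k) 0"
    define D where "D = (\<lambda>m. deriv (\<lambda>t. u0 t $ m) 0)"
    \<comment> \<open>Product and chain rule for \<open>u t = (u t $ k) *s u0 (h t)\<close>. The
      first summand is proportional to \<open>u 0\<close>, so immersivity depends on
      \<open>deriv h 0\<close> alone.\<close>
    have der: "deriv (\<lambda>t. u t $ m) 0 = a * v $ m + c * deriv h 0 * D m" for m
    proof -
      have "deriv (\<lambda>t. u t $ m) 0 = deriv (\<lambda>t. u t $ k * u0 (h t) $ m) 0"
      proof (rule deriv_cong_ev)
        have "\<forall>\<^sub>F t in nhds 0. t \<in> ball 0 s'" using s' by (intro eventually_nhds_in_open) auto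
        then show "\<forall>\<^sub>F t in nhds 0. u t $ m = u t $ k * u0 (h t) $ m"
          by eventually_elim (use fac in \<open>metis vector_smult_component\<close>)
      qed simp
      also have "((\<lambda>t. u t $ k * u0 (h t) $ m) has_field_derivative
          u 0 $ k * (D m * deriv h 0) + a * u0 (h 0) $ m) (at 0)"
      proof (rule DERIV_mult')
        show "((\<lambda>t. u t $ k) has_field_derivative a) (at 0)"
          unfolding a_def using s by (intro holomorphic_derivI[OF hol]) auto
        have "((\<lambda>s. u0 s $ m) has_field_derivative D m) (at (h 0))"
          unfolding h0 D_def using W(1) by (intro holomorphic_derivI[OF hol0]) auto
        moreover have "(h has_field_derivative deriv h 0) (at 0)"
          using s' by (intro holomorphic_derivI[OF holh]) auto
        ultimately show "((\<lambda>t. u0 (h t) $ m) has_field_derivative D m * deriv h 0) (at 0)"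
          by (rule DERIV_chain2)
      qed
      then have "deriv (\<lambda>t. u t $ k * u0 (h t) $ m) 0 = u 0 $ k * (D m * deriv h 0) + a * u0 (h 0) $ m"
        by (rule DERIV_imp_deriv)
      finally show ?thesis by (simp add: uk0 h0 u00 algebra_simps)
    qed
    have "immersive u \<longleftrightarrow> deriv h 0 \<noteq> 0"
    proof
      assume "immersive u"
      show "deriv h 0 \<noteq> 0"
      proof
        assume "deriv h 0 = 0"
        then have "(\<chi> i. deriv (\<lambda>t. u t $ i) 0) = (a / c) *s u 0"
          using c by (simp add: vec_eq_iff der)
        then show False using \<open>immersive u\<close> unfolding immersive_def by blast
      qed
    next
      assume h': "deriv h 0 \<noteq> 0"
      show "immersive u"
        unfolding immersive_def
      proof
        assume "\<exists>b. (\<chi> i. deriv (\<lambda>t. u t $ i) 0) = b *s u 0"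
        then obtain b' where b': "(\<chi> i. deriv (\<lambda>t. u t $ i) 0) = b' *s u 0"
          by blast
        have b: "a * v $ m + c * deriv h 0 * D m = b' * (c * v $ m)" for m
          using arg_cong[OF b', of "\<lambda>x. x $ m"] by (simp add: der c)
        have "a = b' * c" using b[of k] v d_k by (simp add: D_def)
        then show False using b[of i] d_i h' c by (simp add: D_def)
      qed
    qed
    then show ?thesis using s' holh h0 near proj by blast
  qed
  have "chart_at E (proj_pt v) r u0"
    unfolding chart_at_def using disc imm inj u00 fac by (intro conjI allI impI) simp_all
  then show thesis by (rule that)
qed

text \<open>The variable solved for is one whose partial derivative is non-zero: z at
  \<open>O_pt\<close>, where it is 1; otherwise y if possible; otherwise x, by non-singularity.
  \<open>A\<close> and \<open>B\<close> are divided differences of \<open>wform\<close> in the two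
  free coordinates, and \<open>B (0, 0, 0, 0)\<close> is that partial derivative.\<close>

lemma local_chart:
  assumes E: "elliptic_curve E" and Q: "Q \<in> points E"
  obtains r u0 where "chart_at E Q r u0"
proof -
  have w: "wform E (hcoords Q) = 0"
    using Q hcoords_in_proj_curve_iff by (auto simp: proj_curve_def)
  show thesis
  proof (cases Q)
    case O_pt
    show thesis
    proof (rule chart_at_in_coordinates[where i = 1 and j = 3 and k = 2 and v = "hcoords Q" and E = E
          and A = "\<lambda>(s, s', w, w'). a\<^sub>1 E * w - (s\<^sup>2 + s * s' + s'\<^sup>2) - a\<^sub>2 E * (s + s') * w - a\<^sub>4 E * w\<^sup>2"
          and B = "\<lambda>(s, s', w, w'). 1 + a\<^sub>1 E * s' + a\<^sub>3 E * (w + w') - a\<^sub>2 E * s'\<^sup>2 - a\<^sub>4 E * s' * (w + w')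
             - a\<^sub>6 E * (w\<^sup>2 + w * w' + w'\<^sup>2)"], goal_cases)
      case (10 r u0)
      then show thesis using that[of r u0] by simp
    qed (use w O_pt in \<open>simp_all add: wform_def case_prod_unfold power2_eq_square power3_eq_cube algebra_simps
        continuous_intros\<close>)
  next
    case (Aff x y)
    show thesis
    proof (cases "2 * y + a\<^sub>1 E * x + a\<^sub>3 E = 0")
      case False
      show thesis
      proof (rule chart_at_in_coordinates[where i = 1 and j = 2 and k = 3 and v = "hcoords Q" and E = E
            and A = "\<lambda>(s, s', w, w'). a\<^sub>1 E * (y + w)
              - ((x + s)\<^sup>2 + (x + s) * (x + s') + (x + s')\<^sup>2) - a\<^sub>2 E * (2 * x + s + s') - a\<^sub>4 E"
            and B = "\<lambda>(s, s', w, w'). 2 * y + w + w' + a\<^sub>1 E * (x + s') + a\<^sub>3 E"], goal_cases)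
        case (10 r u0)
        then show thesis using that[of r u0] by simp
      qed (use w Aff False in \<open>simp_all add: wform_def case_prod_unfold power2_eq_square power3_eq_cube algebra_simps
          continuous_intros\<close>)
    next
      case True
      then have nz: "a\<^sub>1 E * y - (3 * x\<^sup>2 + 2 * a\<^sub>2 E * x + a\<^sub>4 E) \<noteq> 0"
        using E Q Aff unfolding elliptic_curve_def by blast
      show thesis
      proof (rule chart_at_in_coordinates[where i = 2 and j = 1 and k = 3 and v = "hcoords Q" and E = E
            and A = "\<lambda>(s, s', w, w'). 2 * y + s + s' + a\<^sub>1 E * (x + w) + a\<^sub>3 E"
            and B = "\<lambda>(s, s', w, w'). a\<^sub>1 E * (y + s')
              - ((x + w)\<^sup>2 + (x + w) * (x + w') + (x + w')\<^sup>2) - a\<^sub>2 E * (2 * x + w + w') - a\<^sub>4 E"], goal_cases)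
        case (10 r u0)
        then show thesis using that[of r u0] by simp
      qed (use w Aff nz in \<open>simp_all add: wform_def case_prod_unfold power2_eq_square power3_eq_cube algebra_simps
          continuous_intros\<close>)
    qed
  qed
qed


section \<open>Fibres and ramification\<close>

lemma ball_holomorphic_tendsto:
  assumes "g holomorphic_on ball 0 r" "r > 0"
  shows "(g \<longlongrightarrow> g 0) (nhds (0::complex))"
  using holomorphic_on_imp_continuous_on[OF assms(1)] assms(2)
  by (metis centre_in_ball continuous_on_eq_continuous_at isCont_def open_ball tendsto_at_iff_tendsto_nhds)

lemma holomorphic_nonzero_ball:
  assumes "g holomorphic_on ball 0 r" "r > 0" "g (0::complex) \<noteq> 0"
  obtains s where "0 < s" "s \<le> r" "\<And>t. t \<in> ball 0 s \<Longrightarrow> g t \<noteq> 0"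
proof -
  have "\<forall>\<^sub>F t in nhds 0. g t \<noteq> 0"
    using tendsto_imp_eventually_ne[OF ball_holomorphic_tendsto[OF assms(1,2)] assms(3)] .
  then obtain d where "d > 0" "\<And>t. dist t 0 < d \<Longrightarrow> g t \<noteq> 0"
    unfolding eventually_nhds_metric by blast
  then show thesis
    using that[of "min d r"] assms(2) by (auto simp: dist_commute)
qed

lemma lifted_disc_pos: "lifted_disc E r u \<Longrightarrow> r > 0"
  by (simp add: lifted_disc_def)

lemma lifted_disc_in_points: "lifted_disc E r u \<Longrightarrow> t \<in> ball 0 r \<Longrightarrow> proj_pt (u t) \<in> points E"
  by (auto simp: lifted_disc_def intro: proj_pt_in_points)

lemma lifted_disc_eq_hcoords:
  assumes "lifted_disc E r u" "t \<in> ball 0 r"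
  obtains c where "c \<noteq> 0" "u t = c *s hcoords (proj_pt (u t))"
  using assms proj_curve_eq_hcoords unfolding lifted_disc_def by metis

lemma lifted_disc_mono: "lifted_disc E r u \<Longrightarrow> 0 < s \<Longrightarrow> s \<le> r \<Longrightarrow> lifted_disc E s u"
  unfolding lifted_disc_def by (meson holomorphic_on_subset order_less_le_trans subset_ball subset_eq)

lemma infinite_points:
  assumes "elliptic_curve E"
  shows "infinite (points E)"
proof -
  obtain r u where u: "lifted_disc E r u" "inj_on (\<lambda>t. proj_pt (u t)) (ball 0 r)"
    using local_chart[OF assms O_pt_in_points] chart_atD by metis
  have "infinite ((\<lambda>t. proj_pt (u t)) ` ball 0 r)"
    using finite_imageD[OF _ u(2)] uncountable_ball[OF lifted_disc_pos[OF u(1)], of 0]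
    by (auto dest: countable_finite)
  moreover have "(\<lambda>t. proj_pt (u t)) ` ball 0 r \<subseteq> points E"
    using lifted_disc_in_points[OF u(1)] by blast
  ultimately show ?thesis using finite_subset by blast
qed

text \<open>Only the point at infinity is new. All other points of an injective chart centred there
  are affine, so the value follows by continuity along the chart.\<close>

lemma form_zero_on_curve:
  assumes E: "elliptic_curve E" and F: "form d F"
    and inf: "infinite {P \<in> points E. F (hcoords P) = 0}" and P: "P \<in> points E"
  shows "F (hcoords P) = 0"
proof (cases P)
  case (Aff x y)
  then show ?thesis using form_zero_on_affine[OF F inf] P by simp
next
  case O_pt
  obtain r u where u: "lifted_disc E r u" "proj_pt (u 0) = O_pt"
    "inj_on (\<lambda>t. proj_pt (u t)) (ball 0 r)"
    using local_chart[OF E O_pt_in_points] chart_atD by metis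
  have r: "r > 0" using u(1) by (rule lifted_disc_pos)
  have zero: "F (u t) = 0" if t: "t \<in> ball 0 r" "t \<noteq> 0" for t
  proof -
    have "proj_pt (u t) \<noteq> O_pt"
      using inj_onD[OF u(3), of t 0] u(2) that r by auto
    then obtain x y where xy: "proj_pt (u t) = Aff x y" by (cases "proj_pt (u t)") auto
    then have "F (hcoords (proj_pt (u t))) = 0"
      using form_zero_on_affine[OF F inf] lifted_disc_in_points[OF u(1) that(1)] by simp
    moreover obtain c where "u t = c *s hcoords (proj_pt (u t))"
      using lifted_disc_eq_hcoords[OF u(1) t(1)] by metis
    ultimately show ?thesis using form_scale[OF F] by (metis mult_zero_right)
  qed
  have "(\<lambda>t. F (u t)) holomorphic_on ball 0 r"
    using form_holomorphic[OF F] u(1) by (simp add: lifted_disc_def)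
  then have "((\<lambda>t. F (u t)) \<longlongrightarrow> F (u 0)) (at 0)"
    using ball_holomorphic_tendsto r by (metis tendsto_at_iff_tendsto_nhds)
  moreover have "((\<lambda>t. F (u t)) \<longlongrightarrow> 0) (at 0)"
  proof (rule tendsto_eventually)
    have "\<forall>\<^sub>F t in at 0. t \<in> ball 0 r - {0}"
      using r by (intro eventually_at_in_open) auto
    then show "\<forall>\<^sub>F t in at 0. F (u t) = 0" by eventually_elim (use zero in auto)
  qed
  ultimately have "F (u 0) = 0"
    by (rule tendsto_unique[rotated]) simp
  moreover obtain c where "c \<noteq> 0" "u 0 = c *s hcoords (proj_pt (u 0))"
    using lifted_disc_eq_hcoords[OF u(1), of 0] r by (metis centre_in_ball)
  ultimately show ?thesis
    using form_scale[OF F] O_pt u(2) by (metis mult_eq_0_iff power_eq_0_iff)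
qed

text \<open>On the fibre over \<open>q\<close> the representing forms are zero or proportional to
  \<open>h q\<close>, so their minors against \<open>h q\<close> vanish there. An infinite fibre
  forces these minors to vanish on the whole curve, in particular at the point \<open>P\<close>
  where the representation is valid, so \<open>f P = q\<close> for every \<open>P\<close>.\<close>

lemma morphism_fibre_finite:
  fixes h :: "'q \<Rightarrow> complex ^ 'n"
  assumes E: "elliptic_curve E" and f: "projective_morphism E h f"
    and h_nz: "\<And>q. h q \<noteq> 0" and h_inj: "\<And>q q' c. h q = c *s h q' \<Longrightarrow> q = q'"
    and nc: "\<not> f constant_on points E"
  shows "finite {P \<in> points E. f P = q}"
proof (rule ccontr)
  assume inf: "infinite {P \<in> points E. f P = q}"
  have "f P = q" if P: "P \<in> points E" for P
  proof -
    obtain d F where F: "\<And>i. form d (F i)" "(\<chi> i. F i (hcoords P)) \<noteq> 0"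
      "\<And>Q. Q \<in> points E \<Longrightarrow> (\<chi> i. F i (hcoords Q)) \<noteq> 0 \<Longrightarrow>
          \<exists>c. c \<noteq> 0 \<and> (\<chi> i. F i (hcoords Q)) = c *s h (f Q)"
      using f P unfolding projective_morphism_def by metis
    have "h q $ j * F i (hcoords P) - h q $ i * F j (hcoords P) = 0" for i j
    proof (rule form_zero_on_curve[OF E _ _ P, where F = "\<lambda>v. h q $ j * F i v - h q $ i * F j v"])
      show "form d (\<lambda>v. h q $ j * F i v - h q $ i * F j v)"
        by (intro form_diff form_cmult F)
      have "{P \<in> points E. f P = q} \<subseteq>
          {P \<in> points E. h q $ j * F i (hcoords P) - h q $ i * F j (hcoords P) = 0}"
      proof clarify
        fix Q assume Q: "Q \<in> points E" "q = f Q"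
        show "h (f Q) $ j * F i (hcoords Q) - h (f Q) $ i * F j (hcoords Q) = 0"
        proof (cases "(\<chi> i. F i (hcoords Q)) = 0")
          case True
          then show ?thesis by (simp add: vec_eq_iff)
        next
          case False
          then obtain c where "(\<chi> i. F i (hcoords Q)) = c *s h (f Q)" using F(3) Q by blast
          then have "\<And>i. F i (hcoords Q) = c * h (f Q) $ i" by (simp add: vec_eq_iff)
          then show ?thesis by simp
        qed
      qed
      then show "infinite {P \<in> points E. h q $ j * F i (hcoords P) - h q $ i * F j (hcoords P) = 0}"
        using inf finite_subset by blast
    qed
    then have *: "h q $ j * F i (hcoords P) = h q $ i * F j (hcoords P)" for i j
      by simp
    obtain c where c: "c \<noteq> 0" "(\<chi> i. F i (hcoords P)) = c *s h (f P)"
      using F(2,3) P by blast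
    have Fi: "F i (hcoords P) = c * h (f P) $ i" for i
      using c(2) by (simp add: vec_eq_iff)
    obtain j where j: "h (f P) $ j \<noteq> 0" using h_nz[of "f P"] by (auto simp: vec_eq_iff)
    have "h q = (h q $ j / h (f P) $ j) *s h (f P)"
      using *[of j] c(1) j by (simp add: Fi vec_eq_iff field_simps)
    then show ?thesis using h_inj by blast
  qed
  then show False using nc by (auto simp: constant_on_def)
qed

section \<open>Morphisms along holomorphic discs\<close>

lemma hcoords_inj: "hcoords P = c *s hcoords Q \<Longrightarrow> P = Q"
  by (metis hcoords_nz proj_pt_hcoords proj_pt_scale vector_smult_lzero)

lemma P1_hcoords_nz: "P1_hcoords q \<noteq> 0"
  by (cases q) (auto simp: vec_eq_iff forall_2)

lemma P1_hcoords_inj: "P1_hcoords p = c *s P1_hcoords q \<Longrightarrow> p = q"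
  by (cases p; cases q) (auto simp: vec_eq_iff forall_2)

text \<open>The forms representing \<open>f\<close> at the centre are evaluated along
  \<open>u\<close>. One of them is non-zero at the centre, hence on a smaller disc, where the
  representation therefore remains valid.\<close>

lemma morphism_lift:
  fixes h :: "'q \<Rightarrow> complex ^ 'n"
  assumes f: "projective_morphism E h f" and u: "lifted_disc E r u"
  obtains s U where "0 < s" "s \<le> r" "\<And>i. (\<lambda>t. U t $ i) holomorphic_on ball 0 s"
    "\<And>t. t \<in> ball 0 s \<Longrightarrow> \<exists>c. c \<noteq> 0 \<and> U t = c *s h (f (proj_pt (u t)))"
proof -
  have r: "r > 0" using u by (rule lifted_disc_pos)
  have "proj_pt (u 0) \<in> points E"
    using lifted_disc_in_points[OF u] r by simp
  then obtain d F where F: "\<And>i. form d (F i)" "(\<chi> i. F i (hcoords (proj_pt (u 0)))) \<noteq> 0"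
      "\<And>Q. Q \<in> points E \<Longrightarrow> (\<chi> i. F i (hcoords Q)) \<noteq> 0 \<Longrightarrow>
          \<exists>c. c \<noteq> 0 \<and> (\<chi> i. F i (hcoords Q)) = c *s h (f Q)"
    using f unfolding projective_morphism_def by metis
  define U where "U = (\<lambda>t. \<chi> i. F i (u t))"
  have hol: "(\<lambda>t. U t $ i) holomorphic_on ball 0 r" for i
    using form_holomorphic[OF F(1)] u by (simp add: U_def lifted_disc_def)
  have U: "\<exists>b. b \<noteq> 0 \<and> U t = b *s (\<chi> i. F i (hcoords (proj_pt (u t))))" if t: "t \<in> ball 0 r" for t
  proof -
    obtain c where c: "c \<noteq> 0" "u t = c *s hcoords (proj_pt (u t))"
      using lifted_disc_eq_hcoords[OF u t] by metis
    have "F i (u t) = c ^ d * F i (hcoords (proj_pt (u t)))" for i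
      using form_scale[OF F(1)] c(2) by metis
    then have "U t = c ^ d *s (\<chi> i. F i (hcoords (proj_pt (u t))))"
      by (simp add: U_def vec_eq_iff)
    then show ?thesis using c(1) by (meson power_not_zero)
  qed
  have "U 0 \<noteq> 0" using U[of 0] r F(2) by (metis centre_in_ball vector_mul_eq_0)
  then obtain i where "U 0 $ i \<noteq> 0" by (auto simp: vec_eq_iff)
  then obtain s where s: "0 < s" "s \<le> r" "\<And>t. t \<in> ball 0 s \<Longrightarrow> U t $ i \<noteq> 0"
    using holomorphic_nonzero_ball[OF hol r] by metis
  have "\<And>i. (\<lambda>t. U t $ i) holomorphic_on ball 0 s"
    using holomorphic_on_subset[OF hol subset_ball[OF s(2)]] .
  moreover have "\<exists>c. c \<noteq> 0 \<and> U t = c *s h (f (proj_pt (u t)))" if t: "t \<in> ball 0 s" for t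
  proof -
    have tr: "t \<in> ball 0 r" using t s(2) by simp
    obtain b where b: "b \<noteq> 0" "U t = b *s (\<chi> i. F i (hcoords (proj_pt (u t))))"
      using U[OF tr] by blast
    have "(\<chi> i. F i (hcoords (proj_pt (u t)))) \<noteq> 0"
    proof
      assume "(\<chi> i. F i (hcoords (proj_pt (u t)))) = 0"
      then have "U t = 0" using b(2) by (simp only: vector_smult_rzero)
      then show False using s(3)[OF t] by simp
    qed
    then obtain c where "c \<noteq> 0" "(\<chi> i. F i (hcoords (proj_pt (u t)))) = c *s h (f (proj_pt (u t)))"
      using F(3) lifted_disc_in_points[OF u tr] by blast
    then show ?thesis using b by (intro exI[of _ "b * c"]) simp
  qed
  ultimately show thesis by (rule that[OF s(1,2)])
qed

text \<open>\<open>P1_chart\<close> also takes the value 0 at points outside its domain: at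
  \<open>Infty\<close> for a finite centre, and at \<open>Fin 0\<close> for centre
  \<open>Infty\<close> since 1 / 0 = 0. Shrinking the disc until the denominator has no zero
  excludes them, so that a zero of the coordinate really means the value \<open>q\<close>.\<close>

lemma meromorphic_pullback:
  assumes f: "projective_morphism E P1_hcoords \<phi>" and u: "lifted_disc E r u"
    and q: "q = \<phi> (proj_pt (u 0))"
  obtains s where "0 < s" "s \<le> r"
    "(\<lambda>t. P1_chart q (\<phi> (proj_pt (u t)))) holomorphic_on ball 0 s"
    "\<And>t. t \<in> ball 0 s \<Longrightarrow> P1_chart q (\<phi> (proj_pt (u t))) = 0 \<Longrightarrow> \<phi> (proj_pt (u t)) = q"
proof -
  obtain s U where s: "0 < s" "s \<le> r" "\<And>i. (\<lambda>t. U t $ i) holomorphic_on ball 0 s"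
    "\<And>t. t \<in> ball 0 s \<Longrightarrow> \<exists>c. c \<noteq> 0 \<and> U t = c *s P1_hcoords (\<phi> (proj_pt (u t)))"
    using morphism_lift[OF f u] by metis
  obtain c where c: "c \<noteq> 0" "U 0 = c *s P1_hcoords q" using s(4)[of 0] s(1) q by auto
  show thesis
  proof (cases q)
    case (Fin w)
    then have "U 0 $ 2 \<noteq> 0" using c by simp
    then obtain s' where s': "0 < s'" "s' \<le> s" "\<And>t. t \<in> ball 0 s' \<Longrightarrow> U t $ 2 \<noteq> 0"
      using holomorphic_nonzero_ball[OF s(3) s(1)] by metis
    have eq: "\<phi> (proj_pt (u t)) = Fin (U t $ 1 / U t $ 2)" if t: "t \<in> ball 0 s'" for t
    proof -
      obtain c where "c \<noteq> 0" "U t = c *s P1_hcoords (\<phi> (proj_pt (u t)))"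
        using s(4)[of t] t s'(2) by auto
      then show ?thesis using s'(3)[OF t] by (cases "\<phi> (proj_pt (u t))") auto
    qed
    have "(\<lambda>t. U t $ 1 / U t $ 2 - w) holomorphic_on ball 0 s'"
      using s' by (intro holomorphic_intros holomorphic_on_subset[OF s(3)]) auto
    then have "(\<lambda>t. P1_chart q (\<phi> (proj_pt (u t)))) holomorphic_on ball 0 s'"
      by (rule holomorphic_transform) (simp add: eq Fin)
    moreover have "\<phi> (proj_pt (u t)) = q"
      if "t \<in> ball 0 s'" "P1_chart q (\<phi> (proj_pt (u t))) = 0" for t
      using that eq Fin by simp
    ultimately show thesis by (rule that[OF s'(1) order_trans[OF s'(2) s(2)]])
  next
    case Infty
    then have "U 0 $ 1 \<noteq> 0" using c by simp
    then obtain s' where s': "0 < s'" "s' \<le> s" "\<And>t. t \<in> ball 0 s' \<Longrightarrow> U t $ 1 \<noteq> 0"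
      using holomorphic_nonzero_ball[OF s(3) s(1)] by metis
    have eq: "P1_chart q (\<phi> (proj_pt (u t))) = U t $ 2 / U t $ 1 \<and>
       (P1_chart q (\<phi> (proj_pt (u t))) = 0 \<longrightarrow> \<phi> (proj_pt (u t)) = q)" if t: "t \<in> ball 0 s'" for t
    proof -
      obtain c where "c \<noteq> 0" "U t = c *s P1_hcoords (\<phi> (proj_pt (u t)))"
        using s(4)[of t] t s'(2) by auto
      then show ?thesis using s'(3)[OF t] Infty by (cases "\<phi> (proj_pt (u t))") auto
    qed
    have "(\<lambda>t. U t $ 2 / U t $ 1) holomorphic_on ball 0 s'"
      using s' by (intro holomorphic_intros holomorphic_on_subset[OF s(3)]) auto
    then have "(\<lambda>t. P1_chart q (\<phi> (proj_pt (u t)))) holomorphic_on ball 0 s'"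
      by (rule holomorphic_transform) (simp add: eq)
    moreover have "\<phi> (proj_pt (u t)) = q"
      if "t \<in> ball 0 s'" "P1_chart q (\<phi> (proj_pt (u t))) = 0" for t
      using that eq by blast
    ultimately show thesis by (rule that[OF s'(1) order_trans[OF s'(2) s(2)]])
  qed
qed

lemma P1_chart_self [simp]: "P1_chart q q = 0"
  by (cases q) auto

text \<open>The order is computed in one fixed chart, where finite fibres make the zero isolated.
  Any parametrisation factors through the chart by a map with a simple zero, and orders multiply
  under composition.\<close>

lemma ramification_index_eq:
  assumes E: "elliptic_curve E" and f: "nonconstant_meromorphic E \<phi>" and \<gamma>: "local_param E P \<gamma>"
  shows "ramification_index E \<phi> P \<ge> 1"
    and "zorder (\<lambda>t. P1_chart (\<phi> P) (\<phi> (\<gamma> t))) 0 = int (ramification_index E \<phi> P)"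
proof -
  have mor: "projective_morphism E P1_hcoords \<phi>" and nc: "\<not> \<phi> constant_on points E"
    using f by (auto simp: nonconstant_meromorphic_def)
  have "P \<in> points E"
  proof -
    obtain r u where "\<gamma> 0 = P" "lifted_disc E r u" "\<gamma> 0 = proj_pt (u 0)"
      using \<gamma> unfolding local_param_iff by (metis centre_in_ball lifted_disc_pos)
    then show ?thesis by (metis centre_in_ball lifted_disc_in_points lifted_disc_pos)
  qed
  then obtain r u0 where chart: "chart_at E P r u0"
    using local_chart[OF E] by metis
  note u0 = chart_atD[OF chart]
  define g where "g = (\<lambda>t. P1_chart (\<phi> P) (\<phi> (proj_pt (u0 t))))"
  obtain s where s: "0 < s" "s \<le> r" "g holomorphic_on ball 0 s"
    and gz: "\<And>t. t \<in> ball 0 s \<Longrightarrow> g t = 0 \<Longrightarrow> \<phi> (proj_pt (u0 t)) = \<phi> P"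
    using meromorphic_pullback[OF mor u0(1), of "\<phi> P"] u0(3) unfolding g_def by metis
  have "finite {t \<in> ball 0 s. g t = 0}"
  proof (rule inj_on_finite)
    show "inj_on (\<lambda>t. proj_pt (u0 t)) {t \<in> ball 0 s. g t = 0}"
      using s(2) by (intro inj_on_subset[OF u0(4)]) auto
    show "(\<lambda>t. proj_pt (u0 t)) ` {t \<in> ball 0 s. g t = 0} \<subseteq> {Q \<in> points E. \<phi> Q = \<phi> P}"
      using gz lifted_disc_in_points[OF u0(1)] s(2) by auto
    show "finite {Q \<in> points E. \<phi> Q = \<phi> P}"
      by (rule morphism_fibre_finite[OF E mor P1_hcoords_nz P1_hcoords_inj nc])
  qed
  then have "\<not> 0 islimpt {t \<in> ball 0 s. g t = 0}"
    by (rule islimpt_finite)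
  then have "\<forall>\<^sub>F t in at 0. t \<notin> {t \<in> ball 0 s. g t = 0}"
    unfolding islimpt_iff_eventually by simp
  moreover have "\<forall>\<^sub>F t in at 0. t \<in> ball 0 s"
    using s(1) by (intro eventually_at_in_open') auto
  ultimately have gnz: "\<forall>\<^sub>F t in at 0. g t \<noteq> 0"
    by eventually_elim auto
  have ana: "g analytic_on {0}"
    using s(1,3) by (meson analytic_at centre_in_ball open_ball)
  have "g 0 = 0" using u0(3) by (simp add: g_def)
  then have "zorder g 0 > 0"
    using gnz zorder_pos_iff'[OF ana] by (simp add: eventually_frequently)
  then obtain e where e: "zorder g 0 = int e" "e \<ge> 1"
    by (metis One_nat_def Suc_leI of_nat_0_less_iff zero_less_imp_eq_int)
  have zo: "zorder (\<lambda>t. P1_chart (\<phi> P) (\<phi> (\<gamma> t))) 0 = int e" if lp: "local_param E P \<gamma>" for \<gamma>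
  proof -
    obtain \<rho> u where u: "\<gamma> 0 = P" "lifted_disc E \<rho> u" "immersive u" "\<And>t. t \<in> ball 0 \<rho> \<Longrightarrow> \<gamma> t = proj_pt (u t)"
      using lp unfolding local_param_iff by blast
    have "proj_pt (u 0) = P" using u lifted_disc_pos by fastforce
    then obtain s' h where h: "0 < s'" "s' \<le> \<rho>" "h holomorphic_on ball 0 s'" "h 0 = 0"
      "\<And>t. t \<in> ball 0 s' \<Longrightarrow> proj_pt (u t) = proj_pt (u0 (h t))" "deriv h 0 \<noteq> 0"
      using chart_at_factor[OF chart u(2)] u(3) by metis
    have hana: "h analytic_on {0}"
      using h(1,3) by (meson analytic_at centre_in_ball open_ball)
    have "zorder (\<lambda>t. P1_chart (\<phi> P) (\<phi> (\<gamma> t))) 0 = zorder (g \<circ> h) 0"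
    proof (rule zorder_cong)
      have "\<forall>\<^sub>F t in at 0. t \<in> ball 0 s'"
        using h(1) by (intro eventually_at_in_open') auto
      then show "\<forall>\<^sub>F t in at 0. P1_chart (\<phi> P) (\<phi> (\<gamma> t)) = (g \<circ> h) t"
        by eventually_elim (use h(2,5) u(4) in \<open>auto simp: g_def\<close>)
    qed simp
    also have "\<dots> = zorder g (h 0) * zorder (\<lambda>t. h t - h 0) 0"
    proof (rule zorder_compose')
      show "isolated_singularity_at g (h 0)" "not_essential g (h 0)"
        using ana h(4) by (auto intro: isolated_singularity_at_analytic not_essential_analytic)
      show "\<forall>\<^sub>F w in at (h 0). g w \<noteq> 0" using gnz h(4) by simp
      obtain d where d: "d > 0" "inj_on h (ball 0 d)"
        using has_complex_derivative_locally_injective[OF h(3)] h(1,6) by (metis centre_in_ball open_ball)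
      have "\<forall>\<^sub>F t in at 0. t \<in> ball 0 d - {0}"
        using d(1) by (intro eventually_at_in_open) auto
      then show "\<forall>\<^sub>F t in at 0. h t \<noteq> h 0"
        by eventually_elim (use d inj_onD[OF d(2)] in force)
    qed (rule hana)
    also have "zorder (\<lambda>t. h t - h 0) 0 = 1"
      by (rule zorder_zero_eqI') (use hana h(4,6) in auto)
    finally show ?thesis using e(1) h(4) by simp
  qed
  have "ramification_index E \<phi> P = e"
    unfolding ramification_index_def
  proof (rule the_equality)
    show "\<forall>\<gamma>. local_param E P \<gamma> \<longrightarrow> zorder (\<lambda>t. P1_chart (\<phi> P) (\<phi> (\<gamma> t))) 0 = int e"
      using zo by blast
    \<comment> \<open>The parametrisation given by hypothesis keeps the defining condition from
      being vacuous.\<close>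
    show "e' = e" if "\<forall>\<gamma>. local_param E P \<gamma> \<longrightarrow> zorder (\<lambda>t. P1_chart (\<phi> P) (\<phi> (\<gamma> t))) 0 = int e'" for e'
      using that zo \<gamma> by (metis of_nat_eq_iff)
  qed
  then show "ramification_index E \<phi> P \<ge> 1"
    and "zorder (\<lambda>t. P1_chart (\<phi> P) (\<phi> (\<gamma> t))) 0 = int (ramification_index E \<phi> P)"
    using zo[OF \<gamma>] e(2) by simp_all
qed


section \<open>Isogenies are unramified\<close>

lemma isogeny_in_points: "isogeny E X \<psi> \<Longrightarrow> P \<in> points E \<Longrightarrow> \<psi> P \<in> points X"
  by (auto simp: isogeny_def ec_group_def dest: hom_in_carrier)

lemma isogeny_add:
  "isogeny E X \<psi> \<Longrightarrow> P \<in> points E \<Longrightarrow> Q \<in> points E \<Longrightarrow> \<psi> (ec_add E P Q) = ec_add X (\<psi> P) (\<psi> Q)"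
  using hom_mult[of \<psi> "ec_group E" "ec_group X" P Q] by (simp add: isogeny_def ec_group_def)

text \<open>\<open>hom\<close> provides only additivity; cancellation in O + O = O for the image
  yields the neutral element.\<close>

lemma isogeny_O_pt:
  assumes X: "elliptic_curve X" and \<psi>: "isogeny E X \<psi>"
  shows "\<psi> O_pt = O_pt"
proof -
  have "ec_add X (\<psi> O_pt) (\<psi> O_pt) = ec_add X O_pt (\<psi> O_pt)"
    using isogeny_add[OF \<psi>, of O_pt O_pt] by simp
  then show ?thesis
    using ec_add_right_cancel[OF X] isogeny_in_points[OF \<psi>] O_pt_in_points by metis
qed

lemma isogeny_neg:
  assumes "elliptic_curve X" "isogeny E X \<psi>" "P \<in> points E"
  shows "\<psi> (ec_neg E P) = ec_neg X (\<psi> P)"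
proof -
  have "ec_add X (\<psi> P) (\<psi> (ec_neg E P)) = \<psi> (ec_add E P (ec_neg E P))"
    using isogeny_add[OF assms(2,3)] assms(3) by simp
  also have "\<dots> = O_pt"
    using isogeny_O_pt[OF assms(1,2)] ec_add_eq_O_pt_iff[of E P "ec_neg E P"] by simp
  finally show ?thesis by (simp add: ec_add_eq_O_pt_iff)
qed

lemma isogeny_fibre_finite:
  assumes "elliptic_curve E" "isogeny E X \<psi>" "\<not> \<psi> constant_on points E"
  shows "finite {P \<in> points E. \<psi> P = Q}"
  using assms(2) unfolding isogeny_def
  by (elim conjE) (rule morphism_fibre_finite[OF assms(1) _ hcoords_nz hcoords_inj assms(3)])

text \<open>The injection is A |-> (A - A0) + P, two right translations in succession; A - A0 is
  mapped to the neutral element by \<psi>, so the result lies in the fibre through P.\<close>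

lemma isogeny_fibre_card_le:
  assumes E: "elliptic_curve E" and X: "elliptic_curve X" and \<psi>: "isogeny E X \<psi>"
    and nc: "\<not> \<psi> constant_on points E" and P: "P \<in> points E" and A0: "A0 \<in> points E"
  shows "card {A \<in> points E. \<psi> A = \<psi> A0} \<le> card {A \<in> points E. \<psi> A = \<psi> P}"
proof (rule card_inj_on_le)
  let ?f = "\<lambda>A. ec_add E (ec_add E A (ec_neg E A0)) P"
  have neg: "ec_neg E A0 \<in> points E" using A0 by simp
  show "inj_on ?f {A \<in> points E. \<psi> A = \<psi> A0}"
  proof (rule inj_onI)
    fix A B assume "A \<in> {A \<in> points E. \<psi> A = \<psi> A0}" "B \<in> {A \<in> points E. \<psi> A = \<psi> A0}"
      and eq: "?f A = ?f B"
    then have pts: "A \<in> points E" "B \<in> points E" by auto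
    have "ec_add E A (ec_neg E A0) = ec_add E B (ec_neg E A0)"
      using ec_add_right_cancel[OF E _ _ P eq] ec_add_in_points pts neg by blast
    then show "A = B" using ec_add_right_cancel[OF E pts neg] by blast
  qed
  show "?f ` {A \<in> points E. \<psi> A = \<psi> A0} \<subseteq> {A \<in> points E. \<psi> A = \<psi> P}"
  proof clarify
    fix A assume A: "A \<in> points E" "\<psi> A = \<psi> A0"
    have "ec_add E A (ec_neg E A0) \<in> points E" using ec_add_in_points A(1) neg by blast
    moreover have "\<psi> (ec_add E A (ec_neg E A0)) = O_pt"
      using isogeny_add[OF \<psi> A(1) neg] isogeny_neg[OF X \<psi> A0] A(2)
        ec_add_eq_O_pt_iff[of X "\<psi> A0"] by simp
    ultimately show "?f A \<in> points E \<and> \<psi> (?f A) = \<psi> P"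
      using isogeny_add[OF \<psi> _ P] ec_add_in_points P by simp
  qed
  show "finite {A \<in> points E. \<psi> A = \<psi> P}"
    by (rule isogeny_fibre_finite[OF E \<psi> nc])
qed

section \<open>Counting points of nearby fibres\<close>

lemma eventually_at_right_small: "0 < e \<Longrightarrow> \<forall>\<^sub>F x in at_right (0::real). x < e"
  by (drule eventually_at_right_real) (erule eventually_mono, simp)

text \<open>Projective points agree only if all 2x2 minors of their lifts vanish. Some minor is
  non-zero at the two centres and remains so nearby. Stating this for all small radii lets finitely
  many pairs be handled together.\<close>

lemma proj_pt_separated:
  assumes u: "lifted_disc E r u" and v: "lifted_disc E s v" and ne: "proj_pt (u 0) \<noteq> proj_pt (v 0)"
  shows "\<forall>\<^sub>F \<rho> in at_right 0. \<forall>t \<in> ball 0 \<rho>. \<forall>t' \<in> ball 0 \<rho>. proj_pt (u t) \<noteq> proj_pt (v t')"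
proof -
  have r: "r > 0" "s > 0" using u v by (auto dest: lifted_disc_pos)
  define D where "D = (\<lambda>i j t t'. u t $ i * v t' $ j - u t $ j * v t' $ i)"
  have cross: "D i j t t' = 0"
    if t: "t \<in> ball 0 r" "t' \<in> ball 0 s" "proj_pt (u t) = proj_pt (v t')" for i j t t'
  proof -
    have "u t \<in> proj_curve E" "v t' \<in> proj_curve E"
      using t u v by (auto simp: lifted_disc_def)
    then obtain c where "u t = c *s v t'" using proj_pt_eqD t(3) by metis
    then show ?thesis by (simp add: D_def)
  qed
  have "\<exists>i j. D i j 0 0 \<noteq> 0"
  proof (rule ccontr)
    assume "\<nexists>i j. D i j 0 0 \<noteq> 0"
    then have *: "u 0 $ i * v 0 $ j = u 0 $ j * v 0 $ i" for i j by (simp add: D_def)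
    have nz: "u 0 \<noteq> 0" "v 0 \<noteq> 0" using u v r by (auto simp: lifted_disc_def proj_curve_def)
    then obtain j where j: "v 0 $ j \<noteq> 0" by (auto simp: vec_eq_iff)
    have eq: "u 0 = (u 0 $ j / v 0 $ j) *s v 0"
      using *[of _ j] j by (simp add: vec_eq_iff field_simps)
    then have "u 0 $ j / v 0 $ j \<noteq> 0" using nz(1) by auto
    then show False using ne eq proj_pt_scale by metis
  qed
  then obtain i j where ij: "D i j 0 0 \<noteq> 0" by blast
  have lim: "((\<lambda>t. u t $ i) \<longlongrightarrow> u 0 $ i) (nhds 0)" "((\<lambda>t. v t $ i) \<longlongrightarrow> v 0 $ i) (nhds 0)" for i
    using u v r ball_holomorphic_tendsto[of "\<lambda>t. u t $ i" r] ball_holomorphic_tendsto[of "\<lambda>t. v t $ i" s]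
    by (simp_all add: lifted_disc_def)
  have "((\<lambda>z. D i j (fst z) (snd z)) \<longlongrightarrow> D i j 0 0) (nhds 0 \<times>\<^sub>F nhds 0)"
    unfolding D_def
    by (intro tendsto_intros filterlim_compose[OF lim(1) filterlim_fst] filterlim_compose[OF lim(2) filterlim_snd])
  then have "\<forall>\<^sub>F z in nhds 0 \<times>\<^sub>F nhds 0. D i j (fst z) (snd z) \<noteq> 0"
    using ij tendsto_imp_eventually_ne by blast
  then obtain P Q where PQ: "\<forall>\<^sub>F t in nhds 0. P t" "\<forall>\<^sub>F t in nhds 0. Q t"
    "\<And>t t'. P t \<Longrightarrow> Q t' \<Longrightarrow> D i j t t' \<noteq> 0"
    unfolding eventually_prod_filter by auto
  have "\<forall>\<^sub>F t in nhds 0. P t \<and> Q t" using PQ(1,2) by (rule eventually_conj)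
  then obtain d where d: "d > 0" "\<And>t. dist t 0 < d \<Longrightarrow> P t \<and> Q t"
    unfolding eventually_nhds_metric by blast
  have "\<forall>\<^sub>F \<rho> in at_right 0. \<rho> < Min {d, r, s}"
    using d(1) r by (intro eventually_at_right_small) auto
  then show ?thesis
  proof eventually_elim
    case (elim \<rho>)
    then have \<rho>: "\<rho> < d" "\<rho> < r" "\<rho> < s" by auto
    show ?case
    proof (intro ballI notI)
      fix t t' assume "t \<in> ball 0 \<rho>" "t' \<in> ball 0 \<rho>" "proj_pt (u t) = proj_pt (v t')"
      then show False using cross[of t t' i j] PQ(3)[of t t'] d(2)[of t] d(2)[of t'] \<rho> by simp
    qed
  qed
qed

text \<open>\<open>h\<close> is the expression of \<open>\<psi>\<close> near \<open>R\<close> in the charts \<open>u\<close> at \<open>R\<close> and \<open>uQ\<close> at \<open>\<psi> R\<close>.\<close>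

definition local_expr ::
  "weierstrass \<Rightarrow> (point \<Rightarrow> point) \<Rightarrow> (complex \<Rightarrow> complex ^ 3) \<Rightarrow> point \<Rightarrow> real \<Rightarrow>
    (complex \<Rightarrow> complex ^ 3) \<Rightarrow> (complex \<Rightarrow> complex) \<Rightarrow> bool" where
  "local_expr E \<psi> uQ R s u h \<longleftrightarrow> lifted_disc E s u \<and> proj_pt (u 0) = R
     \<and> inj_on (\<lambda>t. proj_pt (u t)) (ball 0 s) \<and> h holomorphic_on ball 0 s \<and> h 0 = 0
     \<and> (\<forall>t \<in> ball 0 s. \<psi> (proj_pt (u t)) = proj_pt (uQ (h t)))"

lemma local_exprD:
  assumes "local_expr E \<psi> uQ R s u h"
  shows "lifted_disc E s u" "proj_pt (u 0) = R" "inj_on (\<lambda>t. proj_pt (u t)) (ball 0 s)"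
    "h holomorphic_on ball 0 s" "h 0 = 0"
    "\<And>t. t \<in> ball 0 s \<Longrightarrow> \<psi> (proj_pt (u t)) = proj_pt (uQ (h t))"
  using assms by (simp_all add: local_expr_def)

text \<open>\<open>U\<close> lifts \<psi> along the chart \<open>u\<close>, and factoring
  \<open>U\<close> through \<open>uQ\<close> yields \<open>h\<close>. Both are returned:
  \<open>h\<close> serves to count preimages, \<open>U\<close> to make the image of a
  parametrisation a parametrisation of \<open>X\<close>.\<close>

lemma local_expr_exists:
  assumes E: "elliptic_curve E" and \<psi>: "isogeny E X \<psi>"
    and R: "R \<in> points E" and uQ: "chart_at X (\<psi> R) rQ uQ"
  obtains s u h U where "local_expr E \<psi> uQ R s u h" "immersive u" "lifted_disc X s U"
    "\<And>t. t \<in> ball 0 s \<Longrightarrow> proj_pt (U t) = \<psi> (proj_pt (u t))" "immersive U \<longleftrightarrow> deriv h 0 \<noteq> 0"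
proof -
  obtain r u where chart: "chart_at E R r u" using local_chart[OF E R] by metis
  note u = chart_atD[OF chart]
  have mor: "projective_morphism E hcoords \<psi>" using \<psi> by (simp add: isogeny_def)
  obtain s1 U where U: "0 < s1" "s1 \<le> r" "\<And>i. (\<lambda>t. U t $ i) holomorphic_on ball 0 s1"
    "\<And>t. t \<in> ball 0 s1 \<Longrightarrow> \<exists>c. c \<noteq> 0 \<and> U t = c *s hcoords (\<psi> (proj_pt (u t)))"
    using morphism_lift[OF mor u(1)] by metis
  have proj: "proj_pt (U t) = \<psi> (proj_pt (u t)) \<and> U t \<in> proj_curve X" if t: "t \<in> ball 0 s1" for t
  proof -
    obtain c where c: "c \<noteq> 0" "U t = c *s hcoords (\<psi> (proj_pt (u t)))" using U(4)[OF t] by blast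
    have "\<psi> (proj_pt (u t)) \<in> points X"
      using isogeny_in_points[OF \<psi>] lifted_disc_in_points[OF u(1)] t U(2) by simp
    then show ?thesis
      unfolding c(2) by (simp add: c(1) scale_in_proj_curve_iff hcoords_in_proj_curve_iff)
  qed
  have disc: "lifted_disc X s1 U"
    using U(1,3) proj by (simp add: lifted_disc_def)
  have "proj_pt (U 0) = \<psi> R" using proj[of 0] U(1) u(3) by simp
  then obtain s h where h: "0 < s" "s \<le> s1" "h holomorphic_on ball 0 s" "h 0 = 0" "h ` ball 0 s \<subseteq> ball 0 rQ"
    "\<And>t. t \<in> ball 0 s \<Longrightarrow> proj_pt (U t) = proj_pt (uQ (h t))" "immersive U \<longleftrightarrow> deriv h 0 \<noteq> 0"
    using chart_at_factor[OF uQ disc] by metis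
  have sub: "ball 0 s \<subseteq> ball 0 s1" "s \<le> r" using h(2) U(2) by auto
  have eq: "proj_pt (U t) = \<psi> (proj_pt (u t))" if "t \<in> ball 0 s" for t
    using proj that sub(1) by blast
  have "local_expr E \<psi> uQ R s u h"
    unfolding local_expr_def
  proof (intro conjI ballI)
    show "lifted_disc E s u" using lifted_disc_mono[OF u(1) h(1) sub(2)] .
    show "inj_on (\<lambda>t. proj_pt (u t)) (ball 0 s)"
      using inj_on_subset[OF u(4) subset_ball[OF sub(2)]] .
    show "\<psi> (proj_pt (u t)) = proj_pt (uQ (h t))" if "t \<in> ball 0 s" for t
      using eq[OF that] h(6)[OF that] by simp
  qed (use u(3) h in auto)
  then show thesis
    using u(2) lifted_disc_mono[OF disc h(1,2)] eq h(7) by (rule that)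
qed

text \<open>If \<open>h' 0 = 0\<close> at some \<open>P\<close> of a fibre, then \<open>h\<close> takes a value \<open>z\<close> near \<open>0\<close> twice near \<open>P\<close>, while by
  the open mapping theorem \<open>z\<close> is also attained near every other point of the fibre. So the fibre
  over the point with coordinate \<open>z\<close> would be larger than the one through \<open>P\<close>.\<close>

lemma isogeny_unramified:
  assumes E: "elliptic_curve E" and X: "elliptic_curve X" and \<psi>: "isogeny E X \<psi>"
    and nc: "\<not> \<psi> constant_on points E" and P: "P \<in> points E"
    and uQ: "chart_at X (\<psi> P) rQ uQ" and loc: "local_expr E \<psi> uQ P s0 u0 h0"
  shows "deriv h0 0 \<noteq> 0"
proof
  assume d0: "deriv h0 0 = 0"
  define S where "S = {R \<in> points E. \<psi> R = \<psi> P}"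
  have finS: "finite S" unfolding S_def by (rule isogeny_fibre_finite[OF E \<psi> nc])
  have PS: "P \<in> S" using P by (simp add: S_def)
  \<comment> \<open>Radius, disc and expression are packed into one triple for a simultaneous
    choice. At \<open>P\<close> it must be the given triple, because \<open>d0\<close> speaks of
    \<open>h0\<close>.\<close>
  have "\<exists>x. local_expr E \<psi> uQ R (fst x) (fst (snd x)) (snd (snd x)) \<and> (R = P \<longrightarrow> x = (s0, u0, h0))"
    if R: "R \<in> S" for R
  proof (cases "R = P")
    case True
    then show ?thesis using loc by (intro exI[of _ "(s0, u0, h0)"]) simp
  next
    case False
    have "R \<in> points E" "chart_at X (\<psi> R) rQ uQ" using R uQ by (auto simp: S_def)
    then obtain s u h where "local_expr E \<psi> uQ R s u h"
      using local_expr_exists[OF E \<psi>] by metis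
    then show ?thesis using False by (intro exI[of _ "(s, u, h)"]) simp
  qed
  then obtain x where x: "\<And>R. R \<in> S \<Longrightarrow>
      local_expr E \<psi> uQ R (fst (x R)) (fst (snd (x R))) (snd (snd (x R))) \<and> (R = P \<longrightarrow> x R = (s0, u0, h0))"
    by metis
  define s u h where "s = (\<lambda>R. fst (x R))" and "u = (\<lambda>R. fst (snd (x R)))" and "h = (\<lambda>R. snd (snd (x R)))"
  have ex: "local_expr E \<psi> uQ R (s R) (u R) (h R)" if "R \<in> S" for R
    using x that by (simp add: s_def u_def h_def)
  have hP: "h P = h0" using x[OF PS] by (simp add: h_def)
  note D = local_exprD[OF ex]
  have s_pos: "s R > 0" if "R \<in> S" for R using lifted_disc_pos[OF D(1)[OF that]] .
  have "\<forall>\<^sub>F \<rho> in at_right 0. \<forall>R \<in> S. \<forall>R' \<in> S. R \<noteq> R' \<longrightarrow>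
      (\<forall>t \<in> ball 0 \<rho>. \<forall>t' \<in> ball 0 \<rho>. proj_pt (u R t) \<noteq> proj_pt (u R' t'))"
  proof (intro eventually_ball_finite finS ballI)
    fix R R' assume R: "R \<in> S" "R' \<in> S"
    show "\<forall>\<^sub>F \<rho> in at_right 0. R \<noteq> R' \<longrightarrow>
        (\<forall>t \<in> ball 0 \<rho>. \<forall>t' \<in> ball 0 \<rho>. proj_pt (u R t) \<noteq> proj_pt (u R' t'))"
    proof (cases "R = R'")
      case False
      then have "proj_pt (u R 0) \<noteq> proj_pt (u R' 0)" using D(2) R by simp
      then show ?thesis
        using proj_pt_separated[OF D(1)[OF R(1)] D(1)[OF R(2)]] by simp
    qed simp
  qed
  moreover have "\<forall>\<^sub>F \<rho> in at_right 0. \<forall>R \<in> S. \<rho> < s R"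
    using s_pos by (intro eventually_ball_finite finS ballI eventually_at_right_small) auto
  moreover have "\<forall>\<^sub>F \<rho> in at_right (0::real). 0 < \<rho>"
    by (rule eventually_at_right_less)
  ultimately have "\<forall>\<^sub>F \<rho> in at_right 0. 0 < \<rho> \<and> (\<forall>R \<in> S. \<rho> < s R) \<and> (\<forall>R \<in> S. \<forall>R' \<in> S. R \<noteq> R' \<longrightarrow>
      (\<forall>t \<in> ball 0 \<rho>. \<forall>t' \<in> ball 0 \<rho>. proj_pt (u R t) \<noteq> proj_pt (u R' t')))"
    by eventually_elim blast
  \<comment> \<open>With this radius the discs around distinct points of \<open>S\<close> have
    disjoint images and lie in the domains of their expressions.\<close>
  from eventually_happens'[OF trivial_limit_at_right_real this] obtain \<rho> where
    "0 < \<rho> \<and> (\<forall>R \<in> S. \<rho> < s R) \<and> (\<forall>R \<in> S. \<forall>R' \<in> S. R \<noteq> R' \<longrightarrow>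
      (\<forall>t \<in> ball 0 \<rho>. \<forall>t' \<in> ball 0 \<rho>. proj_pt (u R t) \<noteq> proj_pt (u R' t')))" ..
  then have \<rho>: "0 < \<rho>" "\<And>R. R \<in> S \<Longrightarrow> \<rho> < s R" and \<rho>_disj: "\<forall>R \<in> S. \<forall>R' \<in> S. R \<noteq> R' \<longrightarrow>
      (\<forall>t \<in> ball 0 \<rho>. \<forall>t' \<in> ball 0 \<rho>. proj_pt (u R t) \<noteq> proj_pt (u R' t'))"
    by simp_all
  have sub: "ball 0 \<rho> \<subseteq> ball 0 (s R)" if "R \<in> S" for R
    using \<rho>(2)[OF that] by (intro subset_ball) simp
  have inj: "inj_on (\<lambda>t. proj_pt (u R t)) (ball 0 \<rho>)" if "R \<in> S" for R
    using inj_on_subset[OF D(3) sub] that by blast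
  have hol: "h R holomorphic_on ball 0 \<rho>" if "R \<in> S" for R
    using holomorphic_on_subset[OF D(4) sub] that by blast
  have pts: "proj_pt (u R t) \<in> points E" if "R \<in> S" "t \<in> ball 0 \<rho>" for R t
    using lifted_disc_in_points[OF D(1)] sub that by blast
  have \<psi>u: "\<psi> (proj_pt (u R t)) = proj_pt (uQ (h R t))" if "R \<in> S" "t \<in> ball 0 \<rho>" for R t
    using D(6) sub that by blast
  have "\<forall>\<^sub>F \<epsilon> in at_right 0. ball 0 \<epsilon> \<subseteq> h R ` ball 0 \<rho>" if R: "R \<in> S" for R
  proof -
    \<comment> \<open>A constant \<open>h R\<close> would map infinitely many points into one fibre;
      non-constancy is the hypothesis of the open mapping theorem.\<close>
    have "\<not> h R constant_on ball 0 \<rho>"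
    proof
      assume "h R constant_on ball 0 \<rho>"
      then have "h R t = 0" if "t \<in> ball 0 \<rho>" for t
        using that D(5)[OF R] \<rho>(1) unfolding constant_on_def by (metis centre_in_ball)
      then have "(\<lambda>t. proj_pt (u R t)) ` ball 0 \<rho> \<subseteq> {A \<in> points E. \<psi> A = proj_pt (uQ 0)}"
        using pts \<psi>u R by auto
      then have "finite ((\<lambda>t. proj_pt (u R t)) ` ball 0 \<rho>)"
        using isogeny_fibre_finite[OF E \<psi> nc] finite_subset by blast
      then have "finite (ball (0::complex) \<rho>)"
        using finite_imageD inj[OF R] by blast
      then show False using uncountable_ball[OF \<rho>(1), of "0::complex"] by (auto dest: countable_finite)
    qed
    then have "open (h R ` ball 0 \<rho>)"
      using open_mapping_thm[OF hol[OF R]] by auto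
    moreover have "0 \<in> h R ` ball 0 \<rho>" using D(5)[OF R] \<rho>(1) by force
    ultimately obtain e where "e > 0" "ball 0 e \<subseteq> h R ` ball 0 \<rho>"
      using openE by blast
    moreover from \<open>e > 0\<close> have "\<forall>\<^sub>F \<epsilon> in at_right 0. \<epsilon> < e"
      by (rule eventually_at_right_small)
    ultimately show ?thesis
      by (auto elim!: eventually_mono)
  qed
  then have "\<forall>\<^sub>F \<epsilon> in at_right 0. \<forall>R \<in> S. ball 0 \<epsilon> \<subseteq> h R ` ball 0 \<rho>"
    by (intro eventually_ball_finite finS ballI)
  moreover have "\<forall>\<^sub>F \<epsilon> in at_right (0::real). 0 < \<epsilon>"
    by (rule eventually_at_right_less)
  ultimately have "\<forall>\<^sub>F \<epsilon> in at_right 0. 0 < \<epsilon> \<and> (\<forall>R \<in> S. ball 0 \<epsilon> \<subseteq> h R ` ball 0 \<rho>)"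
    by eventually_elim blast
  from eventually_happens'[OF trivial_limit_at_right_real this] obtain \<epsilon> where \<epsilon>:
    "0 < \<epsilon>" "\<And>R. R \<in> S \<Longrightarrow> ball 0 \<epsilon> \<subseteq> h R ` ball 0 \<rho>"
    by blast
  have "(h P \<longlongrightarrow> 0) (nhds 0)"
    using ball_holomorphic_tendsto[OF hol[OF PS] \<rho>(1)] D(5)[OF PS] by simp
  then have "\<forall>\<^sub>F t in nhds 0. h P t \<in> ball 0 \<epsilon>"
    by (rule topological_tendstoD) (use \<epsilon>(1) in auto)
  then obtain d where d: "d > 0" "\<And>t. dist t 0 < d \<Longrightarrow> h P t \<in> ball 0 \<epsilon>"
    unfolding eventually_nhds_metric by blast
  define \<delta> where "\<delta> = min d \<rho>"
  \<comment> \<open>An injective holomorphic function has non-zero derivative. The radius \<delta>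
    is so small that the doubly attained value lies in \<open>ball 0 \<epsilon>\<close>, hence is
    attained near every point of \<open>S\<close>.\<close>
  have "\<not> inj_on (h P) (ball 0 \<delta>)"
  proof
    assume "inj_on (h P) (ball 0 \<delta>)"
    moreover have "h P holomorphic_on ball 0 \<delta>"
      by (rule holomorphic_on_subset[OF hol[OF PS]]) (simp add: \<delta>_def subset_ball)
    ultimately have "deriv (h P) 0 \<noteq> 0"
      using holomorphic_injective_imp_regular[of "h P" "ball 0 \<delta>" 0] d(1) \<rho>(1) by (simp add: \<delta>_def)
    then show False using d0 hP by simp
  qed
  then obtain t1 t2 where t12: "t1 \<in> ball 0 \<delta>" "t2 \<in> ball 0 \<delta>" "t1 \<noteq> t2" "h P t1 = h P t2"
    by (auto simp: inj_on_def)
  define z where "z = h P t1"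
  have t\<rho>: "t1 \<in> ball 0 \<rho>" "t2 \<in> ball 0 \<rho>" using t12 by (auto simp: \<delta>_def)
  have z: "z \<in> ball 0 \<epsilon>" using t12(1) d(2)[of t1] by (simp add: z_def \<delta>_def)
  have "\<exists>t. t \<in> ball 0 \<rho> \<and> h R t = z" if "R \<in> S" for R
    using subsetD[OF \<epsilon>(2)[OF that] z] by (auto simp del: mem_ball)
  then obtain g where g: "\<And>R. R \<in> S \<Longrightarrow> g R \<in> ball 0 \<rho> \<and> h R (g R) = z" by metis
  define a where "a = (\<lambda>R. proj_pt (u R (g R)))"
  define b where "b = (\<lambda>t. proj_pt (u P t))"
  define S' where "S' = {A \<in> points E. \<psi> A = \<psi> (b t1)}"
  have b1: "b t1 \<in> points E" "\<psi> (b t1) = proj_pt (uQ z)"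
    using pts[OF PS t\<rho>(1)] \<psi>u[OF PS t\<rho>(1)] by (simp_all add: b_def z_def)
  have b2: "b t2 \<in> points E" "\<psi> (b t2) = proj_pt (uQ z)"
    using pts[OF PS t\<rho>(2)] \<psi>u[OF PS t\<rho>(2)] t12(4) by (simp_all add: b_def z_def)
  have a: "a R \<in> S'" if "R \<in> S" for R
    using pts[OF that, of "g R"] \<psi>u[OF that, of "g R"] g[OF that] b1(2) by (simp add: a_def S'_def)
  have sub': "a ` (S - {P}) \<union> {b t1, b t2} \<subseteq> S'"
    using a b1 b2 by (auto simp: S'_def)
  have bne: "b t1 \<noteq> b t2"
    using inj_onD[OF inj[OF PS] _ t\<rho>] t12(3) by (auto simp: b_def)
  have inja: "inj_on a (S - {P})"
  proof (rule inj_onI)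
    fix R R' assume "R \<in> S - {P}" "R' \<in> S - {P}" "a R = a R'"
    then show "R = R'" using \<rho>_disj[rule_format, of R R' "g R" "g R'"] g by (auto simp: a_def)
  qed
  have disj: "a ` (S - {P}) \<inter> {b t1, b t2} = {}"
  proof -
    have "a R \<noteq> b t" if "R \<in> S - {P}" "t \<in> ball 0 \<rho>" for R t
      using \<rho>_disj[rule_format, of R P "g R" t] that g PS by (auto simp: a_def b_def)
    then show ?thesis using t\<rho> by blast
  qed
  \<comment> \<open>One preimage near each point of \<open>S\<close> other than \<open>P\<close> and
    two near \<open>P\<close>: the nearby fibre has at least \<open>card S + 1\<close>
    points.\<close>
  have "card (a ` (S - {P}) \<union> {b t1, b t2}) = card (S - {P}) + 2"
    using card_Un_disjoint[OF _ _ disj] finS card_image[OF inja] bne by simp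
  moreover have "card S = card (S - {P}) + 1"
    using card.remove[OF finS PS] by simp
  moreover have "finite S'" unfolding S'_def by (rule isogeny_fibre_finite[OF E \<psi> nc])
  then have "card (a ` (S - {P}) \<union> {b t1, b t2}) \<le> card S'"
    using sub' by (rule card_mono)
  moreover have "card S' \<le> card S"
    unfolding S'_def S_def by (rule isogeny_fibre_card_le[OF E X \<psi> nc P b1(1)])
  ultimately show False by simp
qed

text \<open>Since \<psi> is unramified, it carries a parametrisation \<gamma> at \<open>P\<close> to
  one at \<open>\<psi> P\<close>. Along these two, both indices are the order of one and the same
  function.\<close>

lemma isogeny_ramification:
  assumes E: "elliptic_curve E" and X: "elliptic_curve X" and \<psi>: "isogeny E X \<psi>"
    and nc: "\<not> \<psi> constant_on points E" and P: "P \<in> points E"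
    and \<phi>: "nonconstant_meromorphic X \<phi>" and \<beta>: "nonconstant_meromorphic E (\<phi> \<circ> \<psi>)"
  shows "ramification_index E (\<phi> \<circ> \<psi>) P = ramification_index X \<phi> (\<psi> P)"
proof -
  obtain rQ uQ where uQ: "chart_at X (\<psi> P) rQ uQ"
    using local_chart[OF X] isogeny_in_points[OF \<psi> P] by metis
  obtain s u h U where loc: "local_expr E \<psi> uQ P s u h" "immersive u" "lifted_disc X s U"
    "\<And>t. t \<in> ball 0 s \<Longrightarrow> proj_pt (U t) = \<psi> (proj_pt (u t))" "immersive U \<longleftrightarrow> deriv h 0 \<noteq> 0"
    using local_expr_exists[OF E \<psi> P uQ] by metis
  note D = local_exprD[OF loc(1)]
  have "immersive U" using isogeny_unramified[OF E X \<psi> nc P uQ loc(1)] loc(5) by simp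
  define \<gamma> where "\<gamma> = (\<lambda>t. proj_pt (u t))"
  have \<gamma>: "local_param E P \<gamma>"
    unfolding local_param_iff using D(1,2) loc(2) by (auto simp: \<gamma>_def)
  have \<psi>\<gamma>: "local_param X (\<psi> P) (\<lambda>t. \<psi> (\<gamma> t))"
    unfolding local_param_iff \<gamma>_def
    by (intro conjI exI[of _ s] exI[of _ U] ballI) (use D(2) loc(3,4) \<open>immersive U\<close> in auto)
  show ?thesis
    using ramification_index_eq(2)[OF E \<beta> \<gamma>] ramification_index_eq(2)[OF X \<phi> \<psi>\<gamma>] by simp
qed

lemma nonconstant_meromorphic_isogeny:
  assumes E: "elliptic_curve E" and X: "elliptic_curve X" and \<psi>: "isogeny E X \<psi>"
    and nc: "\<not> \<psi> constant_on points E" and \<phi>: "nonconstant_meromorphic X \<phi>"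
  shows "nonconstant_meromorphic E (\<phi> \<circ> \<psi>)"
  unfolding nonconstant_meromorphic_def
proof
  have mor: "projective_morphism X P1_hcoords \<phi>" and nc\<phi>: "\<not> \<phi> constant_on points X"
    using \<phi> by (auto simp: nonconstant_meromorphic_def)
  have mor': "projective_morphism E hcoords \<psi>" using \<psi> by (simp add: isogeny_def)
  show "projective_morphism E P1_hcoords (\<phi> \<circ> \<psi>)"
    unfolding projective_morphism_def
  proof
    fix P assume P: "P \<in> points E"
    obtain d F where F: "\<And>i. form d (F i)" "(\<chi> i. F i (hcoords P)) \<noteq> 0"
      "\<And>Q. Q \<in> points E \<Longrightarrow> (\<chi> i. F i (hcoords Q)) \<noteq> 0 \<Longrightarrow>
          \<exists>c. c \<noteq> 0 \<and> (\<chi> i. F i (hcoords Q)) = c *s hcoords (\<psi> Q)"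
      using mor' P unfolding projective_morphism_def by metis
    obtain e H where H: "\<And>i. form e (H i)" "(\<chi> i. H i (hcoords (\<psi> P))) \<noteq> 0"
      "\<And>Q. Q \<in> points X \<Longrightarrow> (\<chi> i. H i (hcoords Q)) \<noteq> 0 \<Longrightarrow>
          \<exists>c. c \<noteq> 0 \<and> (\<chi> i. H i (hcoords Q)) = c *s P1_hcoords (\<phi> Q)"
      using mor isogeny_in_points[OF \<psi> P] unfolding projective_morphism_def by metis
    define G where "G = (\<lambda>i v. H i (\<chi> j. F j v))"
    have G: "\<exists>c. c \<noteq> 0 \<and> (\<chi> i. G i (hcoords Q)) = c *s (\<chi> i. H i (hcoords (\<psi> Q)))"
      if Q: "Q \<in> points E" "(\<chi> i. F i (hcoords Q)) \<noteq> 0" for Q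
    proof -
      obtain c where c: "c \<noteq> 0" "(\<chi> i. F i (hcoords Q)) = c *s hcoords (\<psi> Q)"
        using F(3)[OF Q] by blast
      have "(\<chi> i. G i (hcoords Q)) = c ^ e *s (\<chi> i. H i (hcoords (\<psi> Q)))"
        unfolding G_def c(2) by (simp add: vec_eq_iff form_scale[OF H(1)])
      then show ?thesis using c(1) by (meson power_not_zero)
    qed
    \<comment> \<open>A representation must be valid wherever its forms do not all vanish. Constant
      \<open>H\<close> would leave \<open>G\<close> non-zero at common zeros of \<open>F\<close>,
      where nothing is known; positive degree makes \<open>G\<close> vanish there. Constants are
      excluded because they would make \<phi> constant.\<close>
    have "e \<noteq> 0"
    proof
      assume "e = 0"
      then have const: "H i v = H i 0" for i v
        using form_scale[OF H(1), of i 0 v] by simp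
      define w where "w = (\<chi> i. H i 0)"
      have Hw: "(\<chi> i. H i v) = w" for v
        unfolding w_def by (rule Cart_lambda_cong) (rule const)
      have "w \<noteq> 0" using H(2) unfolding Hw .
      have rep: "\<exists>c. c \<noteq> 0 \<and> w = c *s P1_hcoords (\<phi> Q)" if "Q \<in> points X" for Q
        using H(3)[OF that] \<open>w \<noteq> 0\<close> unfolding Hw by blast
      have "\<phi> Q = \<phi> O_pt" if "Q \<in> points X" for Q
      proof -
        obtain c where c: "c \<noteq> 0" "w = c *s P1_hcoords (\<phi> Q)" using rep \<open>Q \<in> points X\<close> by blast
        obtain c' where c': "w = c' *s P1_hcoords (\<phi> O_pt)" using rep[OF O_pt_in_points] by blast
        have "P1_hcoords (\<phi> Q) = (1 / c) *s w" using c by simp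
        also have "\<dots> = (1 / c * c') *s P1_hcoords (\<phi> O_pt)" unfolding c' by simp
        finally show ?thesis by (rule P1_hcoords_inj)
      qed
      then show False using nc\<phi> unfolding constant_on_def by blast
    qed
    show "\<exists>d F. (\<forall>i. form d (F i)) \<and> (\<chi> i. F i (hcoords P)) \<noteq> 0 \<and>
       (\<forall>Q \<in> points E. (\<chi> i. F i (hcoords Q)) \<noteq> 0 \<longrightarrow>
          (\<exists>c. c \<noteq> 0 \<and> (\<chi> i. F i (hcoords Q)) = c *s P1_hcoords ((\<phi> \<circ> \<psi>) Q)))"
    proof (rule exI[of _ "d * e"], rule exI[of _ G], intro conjI allI ballI impI)
      show "form (d * e) (G i)" for i
        unfolding G_def by (rule form_compose[OF H(1) F(1)])
      show "(\<chi> i. G i (hcoords P)) \<noteq> 0"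
        using G[OF P F(2)] H(2) by (metis vector_mul_eq_0)
      fix Q assume Q: "Q \<in> points E" "(\<chi> i. G i (hcoords Q)) \<noteq> 0"
      have "(\<chi> i. F i (hcoords Q)) \<noteq> 0"
      proof
        assume 0: "(\<chi> i. F i (hcoords Q)) = 0"
        have "G i (hcoords Q) = 0" for i
          using form_scale[OF H(1), of i 0 0] \<open>e \<noteq> 0\<close> by (simp add: G_def 0 power_0_left)
        then show False using Q(2) by (simp add: vec_eq_iff)
      qed
      then obtain c where c: "c \<noteq> 0" "(\<chi> i. G i (hcoords Q)) = c *s (\<chi> i. H i (hcoords (\<psi> Q)))"
        using G Q(1) by blast
      then have "(\<chi> i. H i (hcoords (\<psi> Q))) \<noteq> 0" using Q(2) by (metis vector_smult_rzero)
      then obtain c' where c': "c' \<noteq> 0" "(\<chi> i. H i (hcoords (\<psi> Q))) = c' *s P1_hcoords (\<phi> (\<psi> Q))"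
        using H(3) isogeny_in_points[OF \<psi> Q(1)] by blast
      show "\<exists>c. c \<noteq> 0 \<and> (\<chi> i. G i (hcoords Q)) = c *s P1_hcoords ((\<phi> \<circ> \<psi>) Q)"
        using c c' by (intro exI[of _ "c * c'"]) simp
    qed
  qed
  show "\<not> (\<phi> \<circ> \<psi>) constant_on points E"
  proof
    assume "(\<phi> \<circ> \<psi>) constant_on points E"
    then obtain q where q: "\<And>P. P \<in> points E \<Longrightarrow> \<phi> (\<psi> P) = q"
      by (auto simp: constant_on_def)
    \<comment> \<open>Were the composite constant, the infinite curve would be a finite union of
      finite fibres of \<psi>.\<close>
    have "points E \<subseteq> (\<Union>Q \<in> {Q \<in> points X. \<phi> Q = q}. {P \<in> points E. \<psi> P = Q})"
      using q isogeny_in_points[OF \<psi>] by auto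
    moreover have "finite {Q \<in> points X. \<phi> Q = q}"
      by (rule morphism_fibre_finite[OF X mor P1_hcoords_nz P1_hcoords_inj nc\<phi>])
    ultimately have "finite (points E)"
      using isogeny_fibre_finite[OF E \<psi> nc] by (meson finite_UN_I finite_subset)
    then show False using infinite_points[OF E] by simp
  qed
qed


section \<open>Torsion and subgroups\<close>

lemma ec_group_simps [simp]:
  "carrier (ec_group E) = points E" "P \<otimes>\<^bsub>ec_group E\<^esub> Q = ec_add E P Q" "\<one>\<^bsub>ec_group E\<^esub> = O_pt"
  by (simp_all add: ec_group_def)

lemma ec_power_in_points: "P \<in> points E \<Longrightarrow> P [^]\<^bsub>ec_group E\<^esub> (n::nat) \<in> points E"
  by (induction n) (auto intro: ec_add_in_points)

lemma ec_power_isogeny: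
  assumes "elliptic_curve X" "isogeny E X \<psi>" "P \<in> points E"
  shows "\<psi> (P [^]\<^bsub>ec_group E\<^esub> (n::nat)) = \<psi> P [^]\<^bsub>ec_group X\<^esub> n"
  by (induction n)
    (use isogeny_O_pt[OF assms(1,2)] isogeny_add[OF assms(2)] ec_power_in_points assms(3) in auto)

text \<open>Powers grow by a factor P on the right, so right cancellation removes the i common
  factors one at a time.\<close>

lemma ec_power_eq_imp_O_pt:
  assumes E: "elliptic_curve E" and P: "P \<in> points E"
    and "P [^]\<^bsub>ec_group E\<^esub> (i + k) = P [^]\<^bsub>ec_group E\<^esub> (i::nat)"
  shows "P [^]\<^bsub>ec_group E\<^esub> (k::nat) = O_pt"
  using assms(3)
proof (induction i)
  case (Suc i)
  then have "ec_add E (P [^]\<^bsub>ec_group E\<^esub> (i + k)) P = ec_add E (P [^]\<^bsub>ec_group E\<^esub> i) P" by simp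
  then show ?case
    using ec_add_right_cancel[OF E ec_power_in_points[OF P] ec_power_in_points[OF P] P] Suc.IH by blast
qed simp

lemma ec_power_periodic:
  assumes "P [^]\<^bsub>ec_group E\<^esub> (n::nat) = O_pt" "n > 0"
  shows "range (\<lambda>i::nat. P [^]\<^bsub>ec_group E\<^esub> i) \<subseteq> (\<lambda>i. P [^]\<^bsub>ec_group E\<^esub> i) ` {..<n}"
proof -
  have shift: "P [^]\<^bsub>ec_group E\<^esub> (n + i) = P [^]\<^bsub>ec_group E\<^esub> i" for i :: nat
    by (induction i) (use assms in auto)
  have "P [^]\<^bsub>ec_group E\<^esub> i \<in> (\<lambda>i. P [^]\<^bsub>ec_group E\<^esub> i) ` {..<n}" for i :: nat
  proof (induction i rule: less_induct)
    case (less i)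
    show ?case
    proof (cases "i < n")
      case False
      then have "P [^]\<^bsub>ec_group E\<^esub> i = P [^]\<^bsub>ec_group E\<^esub> (i - n)"
        using shift[of "i - n"] by simp
      then show ?thesis using less[of "i - n"] False assms(2) by simp
    qed auto
  qed
  then show ?thesis by blast
qed

lemma torsion_points_isogeny:
  assumes E: "elliptic_curve E" and X: "elliptic_curve X" and \<psi>: "isogeny E X \<psi>"
    and nc: "\<not> \<psi> constant_on points E" and P: "P \<in> points E" and tors: "\<psi> P \<in> torsion_points X"
  shows "P \<in> torsion_points E"
proof -
  let ?pow = "\<lambda>i::nat. P [^]\<^bsub>ec_group E\<^esub> i"
  obtain n :: nat where n: "n > 0" "\<psi> P [^]\<^bsub>ec_group X\<^esub> n = O_pt"
    using tors by (auto simp: torsion_points_def ec_group_def)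
  have "range ?pow \<subseteq> (\<Union>Q \<in> (\<lambda>i. \<psi> P [^]\<^bsub>ec_group X\<^esub> i) ` {..<n}. {A \<in> points E. \<psi> A = Q})"
    using ec_power_periodic[OF n(2,1)] ec_power_in_points[OF P] ec_power_isogeny[OF X \<psi> P] by fastforce
  moreover have "finite (\<Union>Q \<in> (\<lambda>i. \<psi> P [^]\<^bsub>ec_group X\<^esub> i) ` {..<n}. {A \<in> points E. \<psi> A = Q})"
    using isogeny_fibre_finite[OF E \<psi> nc] by blast
  ultimately have "finite (range ?pow)" by (rule finite_subset)
  then have "\<not> inj ?pow" using finite_imageD by blast
  then obtain i j where ij: "i < j" "?pow i = ?pow j"
    unfolding inj_on_def by (metis linorder_neqE_nat)
  then have "?pow (i + (j - i)) = ?pow i" by simp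
  then have "?pow (j - i) = O_pt" by (rule ec_power_eq_imp_O_pt[OF E P])
  then show ?thesis
    using ij(1) P unfolding torsion_points_def by (auto simp: ec_group_def intro!: exI[of _ "j - i"])
qed

lemma subgroup_vimage_isogeny:
  assumes E: "elliptic_curve E" and X: "elliptic_curve X" and \<psi>: "isogeny E X \<psi>"
    and G: "subgroup G (ec_group X)"
  shows "subgroup {P \<in> points E. \<psi> P \<in> G} (ec_group E)"
proof
  \<comment> \<open>\<open>inv\<close> is a definite description; it is resolved directly, for both
    curves, because P + Q = O already forces Q = - P.\<close>
  have inv: "inv\<^bsub>ec_group E\<^esub> P = ec_neg E P" if "P \<in> points E" for P and E :: weierstrass
    unfolding m_inv_def
  proof (rule the_equality)
    show "ec_neg E P \<in> carrier (ec_group E) \<and> P \<otimes>\<^bsub>ec_group E\<^esub> ec_neg E P = \<one>\<^bsub>ec_group E\<^esub>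
        \<and> ec_neg E P \<otimes>\<^bsub>ec_group E\<^esub> P = \<one>\<^bsub>ec_group E\<^esub>"
      using that by (simp add: ec_add_eq_O_pt_iff)
    show "y = ec_neg E P" if "y \<in> carrier (ec_group E) \<and> P \<otimes>\<^bsub>ec_group E\<^esub> y = \<one>\<^bsub>ec_group E\<^esub>
        \<and> y \<otimes>\<^bsub>ec_group E\<^esub> P = \<one>\<^bsub>ec_group E\<^esub>" for y
      using conjunct1[OF conjunct2[OF that]] by (simp add: ec_add_eq_O_pt_iff)
  qed
  show "{P \<in> points E. \<psi> P \<in> G} \<subseteq> carrier (ec_group E)"
    by (auto simp: ec_group_def)
  show "x \<otimes>\<^bsub>ec_group E\<^esub> y \<in> {P \<in> points E. \<psi> P \<in> G}"
    if "x \<in> {P \<in> points E. \<psi> P \<in> G}" "y \<in> {P \<in> points E. \<psi> P \<in> G}" for x y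
    using that subgroup.m_closed[OF G, of "\<psi> x" "\<psi> y"] isogeny_add[OF \<psi>, of x y] ec_add_in_points[of x E y]
    by (simp add: ec_group_def)
  show "\<one>\<^bsub>ec_group E\<^esub> \<in> {P \<in> points E. \<psi> P \<in> G}"
    using subgroup.one_closed[OF G] isogeny_O_pt[OF X \<psi>] by (simp add: ec_group_def)
  show "inv\<^bsub>ec_group E\<^esub> x \<in> {P \<in> points E. \<psi> P \<in> G}" if "x \<in> {P \<in> points E. \<psi> P \<in> G}" for x
    using that subgroup.m_inv_closed[OF G, of "\<psi> x"] isogeny_neg[OF X \<psi>, of x]
      isogeny_in_points[OF \<psi>, of x] by (simp add: inv)
qed

theorem theorem11:
  fixes X E :: weierstrass
    and \<phi> \<beta> :: "point \<Rightarrow> P1"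
    and \<psi> :: "point \<Rightarrow> point"
    and G \<Gamma> :: "point set"
  assumes "toroidal_belyi_pair X \<phi>"
    and "G = quasi_critical_points X \<phi>"
    and "elliptic_curve E"
    and "isogeny E X \<psi>"
    and "\<not> \<psi> constant_on points E"
    and "\<beta> = \<phi> \<circ> \<psi>"
    and "\<Gamma> = quasi_critical_points E \<beta>"
  shows "toroidal_belyi_pair E \<beta>
    \<and> (G \<subseteq> torsion_points X \<longrightarrow> \<Gamma> \<subseteq> torsion_points E)
    \<and> (subgroup G (ec_group X) \<longrightarrow> subgroup \<Gamma> (ec_group E))"
proof -
  note E = \<open>elliptic_curve E\<close> and \<psi> = \<open>isogeny E X \<psi>\<close> and nc = \<open>\<not> \<psi> constant_on points E\<close>
  have X: "elliptic_curve X" and \<phi>: "nonconstant_meromorphic X \<phi>"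
    and crit: "critical_values X \<phi> \<subseteq> {Fin 0, Fin 1, Infty}"
    using assms(1) by (auto simp: toroidal_belyi_pair_def)
  have \<beta>: "nonconstant_meromorphic E \<beta>"
    unfolding \<open>\<beta> = \<phi> \<circ> \<psi>\<close> by (rule nonconstant_meromorphic_isogeny[OF E X \<psi> nc \<phi>])
  have \<Gamma>: "\<Gamma> = {P \<in> points E. \<psi> P \<in> G}"
    using assms(2,6,7) isogeny_in_points[OF \<psi>] by (auto simp: quasi_critical_points_def)
  have "critical_values E \<beta> \<subseteq> critical_values X \<phi>"
  proof
    fix q assume "q \<in> critical_values E \<beta>"
    then obtain P where P: "P \<in> points E" "ramification_index E \<beta> P \<ge> 2" "q = \<beta> P"
      by (auto simp: critical_values_def critical_points_def)
    then have "ramification_index X \<phi> (\<psi> P) \<ge> 2"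
      using isogeny_ramification[OF E X \<psi> nc P(1) \<phi>] \<beta> \<open>\<beta> = \<phi> \<circ> \<psi>\<close> by simp
    then show "q \<in> critical_values X \<phi>"
      using P isogeny_in_points[OF \<psi> P(1)] \<open>\<beta> = \<phi> \<circ> \<psi>\<close>
      by (auto simp: critical_values_def critical_points_def)
  qed
  then have "toroidal_belyi_pair E \<beta>"
    using E \<beta> crit by (auto simp: toroidal_belyi_pair_def)
  moreover have "\<Gamma> \<subseteq> torsion_points E" if "G \<subseteq> torsion_points X"
    using torsion_points_isogeny[OF E X \<psi> nc] that \<Gamma> by auto
  moreover have "subgroup \<Gamma> (ec_group E)" if "subgroup G (ec_group X)"
    unfolding \<Gamma> by (rule subgroup_vimage_isogeny[OF E X \<psi> that])
  ultimately show ?thesis by blast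
qed

end
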